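(* For any positive constant $C_2$ there exist sufficiently small positive constants $C_0$ and $C_1$ (depending only on $C_2$; in particular independent of $\varepsilon$, $H$, $N_0$, $\Omega$ and $\mathcal T$) such that the following holds. Let $\varepsilon>0$, $H>0$, let $N_0\ge 1$ be an integer, and set $\mathring\Omega:=(0,2\varepsilon)\times(-H,H)$. Let $\Omega\supset\mathring\Omega$, let $u(x,y)=e^{-x/\varepsilon}$ be the exact solution of the Laplace equation $-\triangle u=f$ in $\Omega$ (i.e. $f(x,y)=-\varepsilon^{-2}e^{-x/\varepsilon}$) with the corresponding Dirichlet boundary conditions, and let $\mathcal T$ be a triangulation of $\Omega$ that includes as a subtriangulation the triangulation $\mathring{\mathcal T}$ of type C in $\mathring\Omega$ with parameters $(\varepsilon,H,N_0)$. Let $U$ be the lumped-mass linear finite element solution of this problem on $\mathcal T$. If $N_0^{-1}\le C_1$ and $\varepsilon\le C_2H$, then $$\max_{\bar\Omega}|U-u|\ \ge\ C_0\,N_0^{-1}.$$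
   Context: $\Omega\subset\mathbb R^2$ is a bounded polygonal domain and triangulations are conforming. Grid and triangulation of type C in $\mathring\Omega$: let $h:=\varepsilon/N_0$ and $x_i:=hi$ for $i=0,\dots,2N_0$, and consider the rectangular tensor-product grid $\mathring\omega_h:=\{x_i\}_{i=0}^{2N_0}\times\{-H,0,H\}$ in $\mathring\Omega=(0,2\varepsilon)\times(-H,H)$. The triangulation $\mathring{\mathcal T}$ of type C is obtained by cutting each grid rectangle into two triangles by one diagonal, as follows. For $1\le i\le N_0$, each of the two rectangles with vertices $(x_{i-1},0),(x_i,0),(x_{i-1},\pm H),(x_i,\pm H)$ is cut by the diagonal joining $(x_{i-1},0)$ to $(x_i,\pm H)$. For $N_0+1\le i\le 2N_0$, each of these two rectangles is cut by the diagonal joining $(x_i,0)$ to $(x_{i-1},\pm H)$. Thus the node $(x_{N_0},0)$ belongs to exactly 4 triangles, while every other node $(x_i,0)$, $1\le i\le 2N_0-1$, belongs to exactly 6 triangles. "$\mathcal T$ includes $\mathring{\mathcal T}$" means that every triangle of $\mathring{\mathcal T}$ is a triangle of $\mathcal T$; outside $\mathring\Omega$ the triangulation is arbitrary. Lumped-mass linear finite element solution: let $S_h$ be the space of continuous functions on $\bar\Omega$ that are affine on each triangle of $\mathcal T$, and for a continuous function $v$ let $v^I\in S_h$ be its piecewise-linear Lagrange interpolant at the vertices of $\mathcal T$. The solution $U\in S_h$ satisfies $U=u$ at all vertices of $\mathcal T$ on $\partial\Omega$ and $$\int_\Omega\nabla U\cdot\nabla\chi\,dx\,dy=\int_\Omega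 (f\chi)^I\,dx\,dy\qquad\text{for all }\chi\in S_h\text{ with }\chi=0\text{ on }\partial\Omega.$$ *)

theory Defs
  imports "HOL-Analysis.Analysis"
begin

type_synonym point = "real \<times> real"

text \<open>Polygonal domains need not be convex, simply connected or equal to the interior of
  their closure (slits are allowed).\<close>

definition polygonal_domain :: "point set \<Rightarrow> bool" where
  "polygonal_domain \<Omega> \<longleftrightarrow>
     \<Omega> \<noteq> {} \<and> open \<Omega> \<and> connected \<Omega> \<and> bounded \<Omega> \<and>
     (\<exists>E. finite E \<and> (\<forall>(a, b)\<in>E. a \<noteq> b) \<and> frontier \<Omega> = (\<Union>(a, b)\<in>E. closed_segment a b))"

text \<open>Triangles are closed and nondegenerate. Conformity is part of \<^const>\<open>triangulation\<close>:
  the intersection of two members is a (possibly empty) common face of both.\<close>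

definition triangulation_of :: "point set set \<Rightarrow> point set \<Rightarrow> bool" where
  "triangulation_of \<T> \<Omega> \<longleftrightarrow>
     triangulation \<T> \<and> (\<forall>T\<in>\<T>. 2 simplex T) \<and> \<Union>\<T> = closure \<Omega>"

definition vertices :: "point set set \<Rightarrow> point set" where
  "vertices \<T> = {p. \<exists>T\<in>\<T>. p extreme_point_of T}"

text \<open>Mesh functions are total functions on the plane; only their values on the closure of the
  domain are constrained (and used below).\<close>

definition fe_space :: "point set set \<Rightarrow> (point \<Rightarrow> real) set" where
  "fe_space \<T> =
     {v. continuous_on (\<Union>\<T>) v \<and> (\<forall>T\<in>\<T>. \<exists>d c. \<forall>z\<in>T. v z = d \<bullet> z + c)}"

text \<open>The interpolant is unique on the union of the triangles; its values elsewhere are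
  arbitrary.\<close>

definition interpolant :: "point set set \<Rightarrow> (point \<Rightarrow> real) \<Rightarrow> point \<Rightarrow> real" where
  "interpolant \<T> v = (SOME w. w \<in> fe_space \<T> \<and> (\<forall>p\<in>vertices \<T>. w p = v p))"

text \<open>For mesh functions the gradient is meaningful in the interiors of the triangles; the
  remaining part of the domain is a null set.\<close>

definition grad :: "(point \<Rightarrow> real) \<Rightarrow> point \<Rightarrow> point" where
  "grad v z = (THE D. GDERIV v z :> D)"

definition laplacian :: "(point \<Rightarrow> real) \<Rightarrow> point \<Rightarrow> real" where
  "laplacian v = (\<lambda>(x, y). deriv (deriv (\<lambda>s. v (s, y))) x + deriv (deriv (\<lambda>t. v (x, t))) y)"

text \<open>Lumped-mass linear finite element solution of \<open>- laplacian u = f\<close> with Dirichlet data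
  given by \<open>u\<close>.\<close>

definition lumped_mass_solution ::
    "point set \<Rightarrow> point set set \<Rightarrow> (point \<Rightarrow> real) \<Rightarrow> (point \<Rightarrow> real) \<Rightarrow> (point \<Rightarrow> real) \<Rightarrow> bool" where
  "lumped_mass_solution \<Omega> \<T> f u U \<longleftrightarrow>
     U \<in> fe_space \<T> \<and>
     (\<forall>p \<in> vertices \<T> \<inter> frontier \<Omega>. U p = u p) \<and>
     (\<forall>\<phi> \<in> fe_space \<T>. (\<forall>z\<in>frontier \<Omega>. \<phi> z = 0) \<longrightarrow>
        integral \<Omega> (\<lambda>z. grad U z \<bullet> grad \<phi> z) = integral \<Omega> (interpolant \<T> (\<lambda>z. f z * \<phi> z)))"

definition local_domain :: "real \<Rightarrow> real \<Rightarrow> point set" where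
  "local_domain \<epsilon> H = {0<..<2 * \<epsilon>} \<times> {-H<..<H}"

text \<open>The sign \<open>s\<close> ranges over the upper and the lower row of grid rectangles.\<close>

definition type_C :: "real \<Rightarrow> real \<Rightarrow> nat \<Rightarrow> point set set" where
  "type_C \<epsilon> H N\<^sub>0 =
     (let x = (\<lambda>i. \<epsilon> / real N\<^sub>0 * real i) in
        (\<Union>i\<in>{1..N\<^sub>0}. \<Union>s\<in>{H, -H}.
           {convex hull {(x (i - 1), 0), (x i, s), (x i, 0)},
            convex hull {(x (i - 1), 0), (x i, s), (x (i - 1), s)}}) \<union>
        (\<Union>i\<in>{N\<^sub>0 + 1..2 * N\<^sub>0}. \<Union>s\<in>{H, -H}.
           {convex hull {(x i, 0), (x (i - 1), s), (x (i - 1), 0)},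
            convex hull {(x i, 0), (x (i - 1), s), (x i, s)}}))"

definition layer_u :: "real \<Rightarrow> point \<Rightarrow> real" where
  "layer_u \<epsilon> = (\<lambda>(x, y). exp (- x / \<epsilon>))"

definition layer_f :: "real \<Rightarrow> point \<Rightarrow> real" where
  "layer_f \<epsilon> = (\<lambda>(x, y). - (1 / \<epsilon>\<^sup>2) * exp (- x / \<epsilon>))"

lemma layer_u_solves_laplace:
  assumes "\<epsilon> \<noteq> 0"
  shows "- laplacian (layer_u \<epsilon>) z = layer_f \<epsilon> z"
proof -
  have 1: "deriv (\<lambda>s. exp (- s / \<epsilon>)) = (\<lambda>s. - (1 / \<epsilon>) * exp (- s / \<epsilon>))"
    by (rule ext, rule DERIV_imp_deriv) (use assms in \<open>auto intro!: derivative_eq_intros\<close>)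
  have 2: "deriv (\<lambda>s. - (1 / \<epsilon>) * exp (- s / \<epsilon>)) x = 1 / \<epsilon>\<^sup>2 * exp (- x / \<epsilon>)" for x
    by (rule DERIV_imp_deriv)
      (use assms in \<open>auto intro!: derivative_eq_intros simp: power2_eq_square\<close>)
  have 3: "deriv (\<lambda>t::real. c) = (\<lambda>_. 0)" for c :: real
    by (rule ext, rule DERIV_imp_deriv) simp
  show ?thesis
    unfolding laplacian_def layer_u_def layer_f_def
    by (simp only: split_beta fst_conv snd_conv 1 2 3)
qed

end

theory Submission
  imports Defs
begin

text \<open>
  At every interior node of the axis \<open>y = 0\<close> the stiffness matrix gives the standard five-point
  stencil, since all triangles are right-angled with legs parallel to the axes. The lumped load is
  \<open>h H f\<close> at the nodes with six triangles, but only \<open>(2/3) h H f\<close> at \<open>(\<epsilon>, 0)\<close> with its four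
  triangles. Testing with the piecewise linear function that on the axis is the tent with peak
  \<open>N\<^sub>0\<close> at \<open>x = \<epsilon>\<close>, and that vanishes at all other vertices, isolates this defect: second
  differences of the exponential dominate its second derivative, so the ordinary truncation errors
  have the same sign as the defect and can be dropped. What remains is
  \<open>N\<^sub>0 e\<^sup>-\<^sup>1 / 3 \<le> 4 M N\<^sub>0\<^sup>2 (1 + \<epsilon>\<^sup>2 / H\<^sup>2)\<close> for the maximal nodal error \<open>M\<close>.
\<close>

section \<open>Finite elements on conforming triangulations\<close>

text \<open>After translation by a point of \<open>C\<close> the remaining points are linearly
  independent, so the prescribed increments extend to a linear functional; its adjoint supplies the
  vector \<open>d\<close>.\<close>

lemma affine_interpolation:
  fixes C :: "'a::euclidean_space set" and g :: "'a \<Rightarrow> real"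
  assumes "\<not> affine_dependent C"
  shows "\<exists>d c. \<forall>q\<in>C. g q = d \<bullet> q + c"
proof (cases "C = {}")
  case False
  then obtain a where a: "a \<in> C" by auto
  let ?D = "(\<lambda>x. - a + x) ` (C - {a})"
  have "independent ?D"
    using assms affine_dependent_iff_dependent2[OF a] by simp
  then obtain f where f: "linear f" "\<forall>x\<in>?D. f x = g (a + x) - g a"
    using linear_independent_extend[of ?D "\<lambda>x. g (a + x) - g a"] by blast
  define d where "d = adjoint f 1"
  have fd: "f x = d \<bullet> x" for x
    using adjoint_works[OF f(1), of x 1] by (simp add: d_def inner_commute)
  have "g q = d \<bullet> q + (g a - d \<bullet> a)" if "q \<in> C" for q
  proof (cases "q = a")
    case False
    then have "f (- a + q) = g (a + (- a + q)) - g a" using that f(2) by blast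
    then show ?thesis by (simp add: fd inner_add_right inner_diff_right)
  qed simp
  then show ?thesis by blast
qed simp

text \<open>The set where two affine functions agree is the solution set of one linear equation,
  hence convex.\<close>

lemma affine_eq_on_convex_hull:
  fixes d :: "'a::real_inner"
  assumes "\<And>q. q \<in> C \<Longrightarrow> d \<bullet> q + c = d' \<bullet> q + c'" "z \<in> convex hull C"
  shows "d \<bullet> z + c = d' \<bullet> z + c'"
proof -
  have *: "{z. d \<bullet> z + c = d' \<bullet> z + c'} = {z. (d - d') \<bullet> z = c' - c}"
    by (auto simp: algebra_simps)
  have "convex hull C \<subseteq> {z. d \<bullet> z + c = d' \<bullet> z + c'}"
    unfolding * by (rule hull_minimal) (use assms(1) * in \<open>auto intro: convex_hyperplane\<close>)
  then show ?thesis using assms(2) by blast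
qed

lemma simplex_extreme_points:
  fixes T :: "'a::euclidean_space set"
  assumes "n simplex T"
  obtains C where "\<not> affine_dependent C" "T = convex hull C" "C = {q. q extreme_point_of T}"
  using assms unfolding simplex
  by (metis (mono_tags, lifting) Collect_cong Collect_mem_eq
      extreme_point_of_convex_hull_affine_independent)

lemma simplex_compact:
  fixes T :: "'a::euclidean_space set"
  assumes "n simplex T" shows "compact T"
  using assms unfolding simplex by (auto simp: finite_imp_compact_convex_hull)

lemma simplex_convex:
  assumes "n simplex T" shows "convex T"
  using assms unfolding simplex by auto

section \<open>Lagrange interpolation and overlaps of triangles\<close>

context
  fixes \<T> :: "point set set" and \<Omega> :: "point set"
  assumes tri: "triangulation_of \<T> \<Omega>"
begin

lemma triangulation_finite: "finite \<T>"
  and triangulation_simplex: "T \<in> \<T> \<Longrightarrow> 2 simplex T"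
  and triangulation_face: "T \<in> \<T> \<Longrightarrow> T' \<in> \<T> \<Longrightarrow> T \<inter> T' face_of T"
  and triangulation_Union: "\<Union>\<T> = closure \<Omega>"
  using tri by (auto simp: triangulation_of_def triangulation_def)

text \<open>The affine interpolants on the single triangles glue together: two triangles meet in a
  common face, this face is the hull of its extreme points, and these are extreme points of both
  triangles, where both interpolants equal \<open>g\<close>.\<close>

lemma fe_space_interpolation:
  "\<exists>w\<in>fe_space \<T>. \<forall>p\<in>vertices \<T>. w p = g p"
proof -
  have "\<exists>d c. \<forall>q. q extreme_point_of T \<longrightarrow> g q = d \<bullet> q + c" if "T \<in> \<T>" for T
    using simplex_extreme_points[OF triangulation_simplex[OF that]] affine_interpolation
    by (metis (mono_tags, lifting) mem_Collect_eq)
  then obtain d c where dc: "\<And>T q. T \<in> \<T> \<Longrightarrow> q extreme_point_of T \<Longrightarrow> g q = d T \<bullet> q + c T"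
    by metis
  have agree: "d T \<bullet> z + c T = d T' \<bullet> z + c T'"
    if T: "T \<in> \<T>" "T' \<in> \<T>" "z \<in> T" "z \<in> T'" for T T' z
  proof -
    let ?F = "T \<inter> T'"
    have F: "?F face_of T" "?F face_of T'"
      using triangulation_face[OF T(1,2)] triangulation_face[OF T(2,1)] by (simp_all add: Int_commute)
    have "compact ?F" "convex ?F"
      using T(1,2)[THEN triangulation_simplex]
      by (auto intro: convex_Int simplex_convex simplex_compact)
    then have "z \<in> convex hull {q. q extreme_point_of ?F}"
      using Krein_Milman_Minkowski T by blast
    moreover have "d T \<bullet> q + c T = d T' \<bullet> q + c T'" if "q extreme_point_of ?F" for q
      using that dc T F by (metis extreme_point_of_face)
    ultimately show ?thesis
      using affine_eq_on_convex_hull[of "{q. q extreme_point_of ?F}"] by blast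
  qed
  \<comment> \<open>Which triangle is chosen does not matter, by \<open>agree\<close>.\<close>
  define w where "w z = (let T = SOME T. T \<in> \<T> \<and> z \<in> T in d T \<bullet> z + c T)" for z
  have w: "w z = d T \<bullet> z + c T" if "T \<in> \<T>" "z \<in> T" for z T
  proof -
    have "(SOME T. T \<in> \<T> \<and> z \<in> T) \<in> \<T> \<and> z \<in> (SOME T. T \<in> \<T> \<and> z \<in> T)"
      by (rule someI[of _ T]) (use that in auto)
    then show ?thesis
      unfolding w_def Let_def using agree that by blast
  qed
  have "continuous_on (\<Union>T\<in>\<T>. T) w"
  proof (rule continuous_on_closed_Union)
    show "closed T" if "T \<in> \<T>" for T
      using that triangulation_simplex simplex_compact compact_imp_closed by blast
    show "continuous_on T w" if "T \<in> \<T>" for T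
      by (subst continuous_on_cong[OF refl w[OF that]]) (auto intro!: continuous_intros)
  qed (rule triangulation_finite)
  then have "w \<in> fe_space \<T>"
    using w unfolding fe_space_def mem_Collect_eq image_ident by meson
  moreover have "w p = g p" if "p \<in> vertices \<T>" for p
  proof -
    obtain T where T: "T \<in> \<T>" "p extreme_point_of T" using \<open>p \<in> vertices \<T>\<close> by (auto simp: vertices_def)
    then have "p \<in> T" by (simp add: extreme_point_of_def)
    then show ?thesis using w dc T by metis
  qed
  ultimately show ?thesis by blast
qed

lemma interpolant_fe_space: "interpolant \<T> g \<in> fe_space \<T>"
  and interpolant_vertex: "p \<in> vertices \<T> \<Longrightarrow> interpolant \<T> g p = g p"
proof -
  obtain w where "w \<in> fe_space \<T> \<and> (\<forall>p\<in>vertices \<T>. w p = g p)"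
    using fe_space_interpolation[of g] by blast
  then have "interpolant \<T> g \<in> fe_space \<T> \<and> (\<forall>p\<in>vertices \<T>. interpolant \<T> g p = g p)"
    unfolding interpolant_def
    by (rule someI[where P = "\<lambda>w. w \<in> fe_space \<T> \<and> (\<forall>p\<in>vertices \<T>. w p = g p)"])
  then show "interpolant \<T> g \<in> fe_space \<T>" "p \<in> vertices \<T> \<Longrightarrow> interpolant \<T> g p = g p" by auto
qed

lemma fe_space_eq_0:
  assumes "w \<in> fe_space \<T>" "T \<in> \<T>" "\<And>q. q extreme_point_of T \<Longrightarrow> w q = 0" "z \<in> T"
  shows "w z = 0"
proof -
  obtain d c where dc: "\<And>z. z \<in> T \<Longrightarrow> w z = d \<bullet> z + c"
    using assms(1,2) by (auto simp: fe_space_def)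
  obtain C where C: "T = convex hull C" "C = {q. q extreme_point_of T}"
    using simplex_extreme_points triangulation_simplex assms(2) by metis
  have "d \<bullet> q + c = 0 \<bullet> q + 0" if "q \<in> C" for q
  proof -
    have q: "q extreme_point_of T" using that C(2) by blast
    then have "q \<in> T" by (simp add: extreme_point_of_def)
    then show ?thesis using assms(3)[OF q] dc by simp
  qed
  then have "d \<bullet> z + c = 0 \<bullet> z + 0"
    using affine_eq_on_convex_hull C(1) assms(4) by metis
  then show ?thesis using dc assms(4) by simp
qed

text \<open>A proper face lies in the frontier, which is a null set for a convex set. If one
  triangle contains the other, the intersection is still a proper face of the larger one.\<close>

lemma negligible_Int_triangles:
  assumes "T \<in> \<T>" "T' \<in> \<T>" "T \<noteq> T'"
  shows "negligible (T \<inter> T')"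
proof -
  have neg: "negligible F" if "F face_of T" "F \<noteq> T" "T \<in> \<T>" for F T
  proof -
    have "F \<subseteq> rel_frontier T"
      using face_of_subset_rel_frontier that by blast
    also have "\<dots> \<subseteq> frontier T"
      using interior_subset_rel_interior by (auto simp: rel_frontier_def frontier_def)
    finally have "F \<subseteq> frontier T" .
    then show ?thesis
      using negligible_convex_frontier negligible_subset simplex_convex triangulation_simplex that(3)
      by metis
  qed
  show ?thesis
  proof (cases "T \<inter> T' = T")
    case True
    then have "T \<inter> T' \<noteq> T'" using assms by auto
    then show ?thesis
      using neg[of "T \<inter> T'" T'] triangulation_face[OF assms(2,1)] assms by (simp add: Int_commute)
  qed (use neg triangulation_face assms in blast)
qed

text \<open>Otherwise the nonempty open set \<open>interior T \<inter> V\<close> would be covered by the negligible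
  intersections of \<open>T\<close> with the members of \<open>\<S>\<close>.\<close>

lemma triangle_meets_open:
  assumes "open V" "finite \<S>" "\<S> \<subseteq> \<T>" "V \<subseteq> \<Union>\<S>" "T \<in> \<T>" "T \<inter> V \<noteq> {}"
  shows "T \<in> \<S>"
proof (rule ccontr)
  assume T: "T \<notin> \<S>"
  have cT: "convex T" "closed T" "interior T \<noteq> {}"
  proof -
    show "convex T" "closed T"
      using triangulation_simplex simplex_convex simplex_compact compact_imp_closed assms(5) by blast+
    have "aff_dim T = 2"
      using triangulation_simplex[OF assms(5)] aff_dim_simplex by blast
    then have "\<not> T \<subseteq> {x. a \<bullet> x = b}" if "a \<noteq> 0" for a b
      using aff_dim_subset[of T "{x. a \<bullet> x = b}"] aff_dim_hyperplane[OF that] by auto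
    then show "interior T \<noteq> {}"
      using \<open>convex T\<close> empty_interior_subset_hyperplane by metis
  qed
  \<comment> \<open>\<open>T\<close> is the closure of its interior, so an open set that meets
    \<open>T\<close> also meets \<open>interior T\<close>.\<close>
  have "interior T \<inter> V \<noteq> {}"
    using assms(6) convex_closure_interior[OF cT(1,3)] closure_closed[OF cT(2)]
      open_Int_closure_eq_empty[OF assms(1), of "interior T"] by (auto simp: Int_commute)
  moreover have "negligible (interior T \<inter> V)"
  proof (rule negligible_subset)
    show "negligible (\<Union>S\<in>\<S>. T \<inter> S)"
      using assms T negligible_Int_triangles by (intro negligible_Union) auto
  qed (use assms(4) interior_subset in fastforce)
  ultimately show False
    using open_not_negligible[of "interior T \<inter> V"] assms(1) by auto
qed

end

section \<open>Integration over right triangles\<close>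

text \<open>\<open>R\<close> is the corner with the right angle; \<open>a\<close> and
  \<open>b\<close> are signed leg lengths, so that all four orientations are covered.\<close>

definition right_triangle :: "point \<Rightarrow> real \<Rightarrow> real \<Rightarrow> point set" where
  "right_triangle R a b = convex hull {R, R + (a, 0), R + (0, b)}"

lemma mem_right_triangle:
  "z \<in> right_triangle R a b \<longleftrightarrow>
     (\<exists>s t. 0 \<le> s \<and> 0 \<le> t \<and> s + t \<le> 1 \<and> z = (fst R + s * a, snd R + t * b))"
proof -
  have "z \<in> right_triangle R a b \<longleftrightarrow>
      (\<exists>s t. 0 \<le> s \<and> 0 \<le> t \<and> s + t \<le> 1 \<and> z = R + s *\<^sub>R (R + (a, 0) - R) + t *\<^sub>R (R + (0, b) - R))"
    unfolding right_triangle_def convex_hull_3_alt by blast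
  then show ?thesis
    by (cases R) (auto simp: mult.commute)
qed

lemma right_triangle_compact: "compact (right_triangle R a b)"
  and right_triangle_convex: "convex (right_triangle R a b)"
  by (auto simp: right_triangle_def finite_imp_compact_convex_hull)

lemma mem_right_triangle_corners:
  fixes a b :: real
  shows "R \<in> right_triangle R a b" "R + (a, 0) \<in> right_triangle R a b" "R + (0, b) \<in> right_triangle R a b"
  by (auto simp: right_triangle_def hull_inc)

text \<open>Vertex quadrature is exact for affine functions: area times the mean of the corner
  values. The proof maps the unit triangle affinely onto the given one and applies Fubini.\<close>

lemma has_integral_right_triangle:
  assumes ab: "a \<noteq> 0" "b \<noteq> 0"
    and w: "\<And>z. z \<in> right_triangle R a b \<Longrightarrow> w z = d \<bullet> z + c"
  shows "(w has_integral \<bar>a * b\<bar> / 6 * (w R + w (R + (a, 0)) + w (R + (0, b)))) (right_triangle R a b)"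
proof -
  let ?T = "right_triangle R a b"
  define F where "F z = indicator ?T z *\<^sub>R (d \<bullet> z + c)" for z
  obtain p q where R: "R = (p, q)" by (cases R)
  define A B C where "A = w R" and "B = w (R + (a, 0)) - w R" and "C = w (R + (0, b)) - w R"
  have ABC: "A = fst d * p + snd d * q + c" "B = fst d * a" "C = snd d * b"
    using w mem_right_triangle_corners[where R = R and a = a and b = b]
    by (auto simp: A_def B_def C_def R inner_prod_def algebra_simps)
  have int: "integrable lborel F"
    unfolding F_def by (intro borel_integrable_compact right_triangle_compact continuous_intros)
  \<comment> \<open>In the coordinates \<open>s\<close>, \<open>t\<close> of the unit triangle the
    integrand is \<open>A + B * s + C * t\<close>, where \<open>A\<close> is the value at the right
    angle and \<open>B\<close>, \<open>C\<close> are the increments along the legs.\<close>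
  have F: "F (p + a * s, q + b * t) =
      indicator {0..1} s * (((A + B * s) + C * t) * indicator {0..1 - s} t)" for s t
  proof -
    have "(p + a * s, q + b * t) \<in> ?T \<longleftrightarrow> 0 \<le> s \<and> 0 \<le> t \<and> s + t \<le> 1"
      using ab by (auto simp: mem_right_triangle R mult.commute)
    then show ?thesis
      by (auto simp: F_def indicator_def ABC inner_prod_def algebra_simps)
  qed
  have inner: "(\<integral>t. ((A + B * s) + C * t) * indicator {0..1 - s} t \<partial>lborel) =
      (A + B * s) * (1 - s) + C * (1 - s)\<^sup>2 / 2" if "s \<in> {0..1}" for s
    using that
    by (subst integral_FTC_Icc_real[where F = "\<lambda>t. (A + B * s) * t + C * t\<^sup>2 / 2"])
      (auto intro!: derivative_eq_intros)
  have outer: "(\<integral>s. ((A + B * s) * (1 - s) + C * (1 - s)\<^sup>2 / 2) * indicator {0..1} s \<partial>lborel) =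
      A / 2 + B / 6 + C / 6"
    by (subst integral_FTC_Icc_real[where F = "\<lambda>s. A * (s - s\<^sup>2 / 2) + B * (s\<^sup>2 / 2 - s ^ 3 / 3) - C * (1 - s) ^ 3 / 6"])
      (auto intro!: derivative_eq_intros simp: field_simps power2_eq_square)
  have "integral\<^sup>L lborel F = (\<integral>x. (\<integral>y. F (x, y) \<partial>lborel) \<partial>lborel)"
    by (rule lborel_pair.integral_fst'[of F, unfolded lborel_prod, OF int, symmetric])
  also have "\<dots> = \<bar>a\<bar> * (\<integral>s. (\<integral>y. F (p + a * s, y) \<partial>lborel) \<partial>lborel)"
    using lborel_integral_real_affine[OF ab(1), of "\<lambda>x. \<integral>y. F (x, y) \<partial>lborel" p] by simp
  also have "(\<lambda>s. \<integral>y. F (p + a * s, y) \<partial>lborel) = (\<lambda>s. \<bar>b\<bar> * (\<integral>t. F (p + a * s, q + b * t) \<partial>lborel))"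
    using lborel_integral_real_affine[OF ab(2), of "\<lambda>y. F (p + a * s, y)" q for s] by simp
  also have "\<dots> = (\<lambda>s. \<bar>b\<bar> * (((A + B * s) * (1 - s) + C * (1 - s)\<^sup>2 / 2) * indicator {0..1} s))"
    unfolding F using inner by (auto simp: fun_eq_iff indicator_def)
  also have "(\<integral>s. \<bar>b\<bar> * (((A + B * s) * (1 - s) + C * (1 - s)\<^sup>2 / 2) * indicator {0..1} s) \<partial>lborel) =
      \<bar>b\<bar> * (A / 2 + B / 6 + C / 6)"
    by (simp add: outer)
  also have "\<bar>a\<bar> * \<dots> = \<bar>a * b\<bar> / 6 * (w R + w (R + (a, 0)) + w (R + (0, b)))"
    by (simp add: A_def B_def C_def abs_mult field_simps)
  finally have I: "integral\<^sup>L lborel F = \<bar>a * b\<bar> / 6 * (w R + w (R + (a, 0)) + w (R + (0, b)))" .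
  have "F = (\<lambda>z. if z \<in> ?T then w z else 0)"
    by (rule ext) (simp add: F_def w)
  then show ?thesis
    using has_integral_integral_lborel[OF int] unfolding I by (simp only: has_integral_restrict_UNIV)
qed

lemma has_integral_fe_space_right_triangle:
  assumes "w \<in> fe_space \<T>" "right_triangle R a b \<in> \<T>" "a \<noteq> 0" "b \<noteq> 0"
  shows "(w has_integral \<bar>a * b\<bar> / 6 * (w R + w (R + (a, 0)) + w (R + (0, b)))) (right_triangle R a b)"
proof -
  obtain d c where "\<forall>z\<in>right_triangle R a b. w z = d \<bullet> z + c"
    using assms(1,2) unfolding fe_space_def by blast
  then show ?thesis
    by (intro has_integral_right_triangle assms(3,4)) blast
qed

text \<open>Uniqueness of the derivative at an interior point makes the definite description in
  \<open>grad\<close> denote \<open>d\<close>.\<close>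

lemma grad_affine:
  assumes "z \<in> interior T" "\<And>z. z \<in> T \<Longrightarrow> v z = d \<bullet> z + c"
  shows "grad v z = d"
proof -
  have D: "GDERIV v z :> d"
    unfolding gderiv_def
  proof (rule has_derivative_transform_within_open)
    show "((\<lambda>z. d \<bullet> z + c) has_derivative (\<lambda>h. h \<bullet> d)) (at z)"
      by (auto intro!: derivative_eq_intros simp: inner_commute)
    show "open (interior T)" "z \<in> interior T" using assms(1) by auto
    show "d \<bullet> y + c = v y" if "y \<in> interior T" for y
      using assms(2)[of y] interior_subset[of T] that by auto
  qed
  have "D = d" if "GDERIV v z :> D" for D
    using has_derivative_unique[OF D[unfolded gderiv_def] that[unfolded gderiv_def]]
    by (metis inner_commute vector_eq_ldot)
  then show ?thesis
    unfolding grad_def using D by blast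
qed

section \<open>Integrals over the domain as sums over triangles\<close>

context
  fixes \<T> :: "point set set" and \<Omega> :: "point set"
  assumes tri: "triangulation_of \<T> \<Omega>"
begin

text \<open>The legs are parallel to the axes, so the gradient components are difference quotients
  along them, and the constant inner product is multiplied by the area. No product couples the ends
  of the hypotenuse, whence the five-point stencil. The frontier, where \<open>grad\<close> is not
  controlled, is a null set.\<close>

lemma has_integral_grad_inner_right_triangle:
  assumes "v \<in> fe_space \<T>" "w \<in> fe_space \<T>" "right_triangle R a b \<in> \<T>" "a \<noteq> 0" "b \<noteq> 0"
  shows "((\<lambda>z. grad v z \<bullet> grad w z) has_integral
           \<bar>a * b\<bar> / 2 * ((v (R + (a, 0)) - v R) * (w (R + (a, 0)) - w R) / a\<^sup>2 +
                           (v (R + (0, b)) - v R) * (w (R + (0, b)) - w R) / b\<^sup>2)) (right_triangle R a b)"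
    (is "(_ has_integral ?I) ?T")
proof -
  obtain d c where v: "\<And>z. z \<in> ?T \<Longrightarrow> v z = d \<bullet> z + c"
    using assms(1,3) by (auto simp: fe_space_def)
  obtain d' c' where w: "\<And>z. z \<in> ?T \<Longrightarrow> w z = d' \<bullet> z + c'"
    using assms(2,3) by (auto simp: fe_space_def)
  have "((\<lambda>z. d \<bullet> d') has_integral \<bar>a * b\<bar> / 6 * (d \<bullet> d' + d \<bullet> d' + d \<bullet> d')) ?T"
    by (rule has_integral_right_triangle[where d = 0]) (use assms in auto)
  moreover have "\<bar>a * b\<bar> / 6 * (d \<bullet> d' + d \<bullet> d' + d \<bullet> d') = ?I"
    using assms(4,5) mem_right_triangle_corners[where R = R and a = a and b = b]
    by (simp add: v w inner_add_right inner_prod_def power2_eq_square algebra_simps)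
  ultimately have "((\<lambda>z. d \<bullet> d') has_integral ?I) ?T" by metis
  then show ?thesis
  proof (rule has_integral_spike[of "frontier ?T", rotated 2])
    show "grad v z \<bullet> grad w z = d \<bullet> d'" if "z \<in> ?T - frontier ?T" for z
    proof -
      have "z \<in> interior ?T" using that closure_subset[of ?T] by (auto simp: frontier_def)
      then show ?thesis using grad_affine v w by metis
    qed
  qed (simp add: negligible_convex_frontier right_triangle_convex)
qed

lemma has_integral_grad_inner_zero:
  assumes "T \<in> \<T>" "\<And>z. z \<in> T \<Longrightarrow> w z = 0"
  shows "((\<lambda>z. grad v z \<bullet> grad w z) has_integral 0) T"
proof (rule has_integral_spike[of "frontier T"])
  show "negligible (frontier T)"
    using negligible_convex_frontier simplex_convex triangulation_simplex[OF tri assms(1)] by blast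
  show "grad v z \<bullet> grad w z = 0" if "z \<in> T - frontier T" for z
  proof -
    have "z \<in> interior T" using that closure_subset[of T] by (auto simp: frontier_def)
    then have "grad w z = 0" by (rule grad_affine[where c = 0]) (simp add: assms(2))
    then show ?thesis by simp
  qed
  show "((\<lambda>z. 0::real) has_integral 0) T" by simp
qed

text \<open>By counting: a 2-simplex has exactly three extreme points, and they are among the three
  points that span the hull.\<close>

lemma extreme_point_of_right_triangle:
  assumes "right_triangle R a b \<in> \<T>"
  shows "q extreme_point_of right_triangle R a b \<longleftrightarrow> q \<in> {R, R + (a, 0), R + (0, b)}"
proof -
  obtain C where C: "card C = 3" "{q. q extreme_point_of right_triangle R a b} = C"
    using triangulation_simplex[OF tri assms] unfolding simplex_def
    by (auto simp: extreme_point_of_convex_hull_affine_independent)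
  have "C \<subseteq> {R, R + (a, 0), R + (0, b)}"
    using C(2) extreme_point_of_convex_hull unfolding right_triangle_def by blast
  moreover have "card {R, R + (a, 0), R + (0, b)} \<le> 3"
    by (simp add: card_insert_if)
  ultimately have "C = {R, R + (a, 0), R + (0, b)}"
    using C(1) by (intro card_seteq) auto
  then show ?thesis using C(2) by blast
qed

text \<open>\<open>t\<close> enumerates the triangles that may contribute. Triangles overlap in null
  sets only, and \<open>\<Omega>\<close> differs from the union of all triangles by a part of its
  null frontier.\<close>

lemma integral_eq_sum_triangles:
  fixes f :: "point \<Rightarrow> real"
  assumes neg: "negligible (frontier \<Omega>)"
    and I: "finite I" "inj_on t I" "t ` I \<subseteq> \<T>"
    and int: "\<And>i. i \<in> I \<Longrightarrow> (f has_integral c i) (t i)"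
    and zero: "\<And>T. T \<in> \<T> \<Longrightarrow> T \<notin> t ` I \<Longrightarrow> (f has_integral 0) T"
  shows "integral \<Omega> f = sum c I"
proof -
  define c' where "c' T = (if T \<in> t ` I then c (inv_into I t T) else 0)" for T
  have "(f has_integral c' T) T" if "T \<in> \<T>" for T
    using that int zero I(2) by (auto simp: c'_def)
  then have "(f has_integral sum c' \<T>) (\<Union>\<T>)"
    using negligible_Int_triangles[OF tri] triangulation_finite[OF tri]
    by (intro has_integral_Union) (auto simp: pairwise_def)
  also have "sum c' \<T> = sum c' (t ` I)"
    using I(3) triangulation_finite[OF tri] by (intro sum.mono_neutral_right) (auto simp: c'_def)
  also have "\<dots> = sum c I"
    using I(2) by (simp add: sum.reindex c'_def)
  finally have "(f has_integral sum c I) (closure \<Omega>)"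
    by (simp add: triangulation_Union[OF tri])
  then have "(f has_integral sum c I) \<Omega>"
  proof (subst has_integral_spike_set_eq[of \<Omega> "closure \<Omega>"])
    show "negligible {x \<in> closure \<Omega> - \<Omega>. f x \<noteq> 0}"
      by (rule negligible_subset[OF neg]) (use interior_subset in \<open>auto simp: frontier_def\<close>)
    have "{x \<in> \<Omega> - closure \<Omega>. f x \<noteq> 0} = {}"
      using closure_subset by auto
    then show "negligible {x \<in> \<Omega> - closure \<Omega>. f x \<noteq> 0}" by (simp only: negligible_empty)
  qed
  then show ?thesis by (rule integral_unique)
qed

end

lemma negligible_frontier_polygonal_domain:
  assumes "polygonal_domain \<Omega>"
  shows "negligible (frontier \<Omega>)"
proof -
  obtain E where E: "finite E" "frontier \<Omega> = (\<Union>(a, b)\<in>E. closed_segment a b)"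
    using assms by (auto simp: polygonal_domain_def)
  have "negligible (closed_segment a b)" for a b :: point
    using negligible_convex_interior[of "closed_segment a b"] interior_closed_segment_ge2[of a b]
    by simp
  then show ?thesis unfolding E(2) using E(1) by (intro negligible_Union) auto
qed

text \<open>Three times the centroid is the integral of the identity divided by a third of the area,
  so it depends on the triangle only as a set.\<close>

lemma centroid_unique:
  assumes "right_triangle R a b = right_triangle R' a' b'" "a \<noteq> 0" "b \<noteq> 0" "\<bar>a' * b'\<bar> = \<bar>a * b\<bar>"
  shows "3 *\<^sub>R R + (a, b) = 3 *\<^sub>R R' + (a', b')"
proof -
  have ab': "a' \<noteq> 0" "b' \<noteq> 0" using assms by auto
  have "d \<bullet> (3 *\<^sub>R R + (a, b)) = d \<bullet> (3 *\<^sub>R R' + (a', b'))" for d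
  proof -
    have "\<bar>a * b\<bar> / 6 * (d \<bullet> R + d \<bullet> (R + (a, 0)) + d \<bullet> (R + (0, b))) =
        \<bar>a * b\<bar> / 6 * (d \<bullet> R' + d \<bullet> (R' + (a', 0)) + d \<bullet> (R' + (0, b')))"
      using has_integral_unique[OF has_integral_right_triangle[OF assms(2,3), of R "(\<bullet>) d" d 0]]
        has_integral_right_triangle[OF ab', of R' "(\<bullet>) d" d 0] assms(1,4)
      by simp
    then have "d \<bullet> R + d \<bullet> (R + (a, 0)) + d \<bullet> (R + (0, b)) = d \<bullet> R' + d \<bullet> (R' + (a', 0)) + d \<bullet> (R' + (0, b'))"
      using assms(2,3) by simp
    then show ?thesis by (simp add: inner_add_right inner_prod_def algebra_simps)
  qed
  then show ?thesis using vector_eq_ldot by blast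
qed

section \<open>The triangulation of type C\<close>

locale layer_mesh =
  fixes \<epsilon> H :: real and N :: nat and \<Omega> :: "point set" and \<T> :: "point set set"
  assumes eps_pos: "\<epsilon> > 0" and H_pos: "H > 0" and N_pos: "N \<ge> 1"
    and domain: "polygonal_domain \<Omega>" and local_subset: "local_domain \<epsilon> H \<subseteq> \<Omega>"
    and tri: "triangulation_of \<T> \<Omega>" and type_C: "type_C \<epsilon> H N \<subseteq> \<T>"
begin

definition h :: real where "h = \<epsilon> / real N"

lemma h_pos: "h > 0" and N_h: "real N * h = \<epsilon>"
  using eps_pos N_pos by (auto simp: h_def)

text \<open>Nodes are counted from the outer boundary of each half: \<open>X 1 j\<close> is the paper's \<open>x\<^sub>j\<close> and
  \<open>X (-1) j\<close> is \<open>x\<close> with index \<open>2 N - j\<close>. The reflection in the line \<open>x = \<epsilon>\<close> thus becomes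
  \<open>\<tau> \<mapsto> -\<tau>\<close>.\<close>

definition X :: "real \<Rightarrow> nat \<Rightarrow> real" where
  "X \<tau> j = \<epsilon> - \<tau> * (real N - real j) * h"

lemma X_pred: "j \<ge> 1 \<Longrightarrow> X \<tau> (j - 1) = X \<tau> j - \<tau> * h"
  by (simp add: X_def of_nat_diff algebra_simps)

text \<open>\<open>lower\<close> and \<open>upper\<close> are the halves of the rectangle between
  nodes \<open>j - 1\<close> and \<open>j\<close>, cut by the diagonal from
  \<open>(X \<tau> (j - 1), 0)\<close> to \<open>(X \<tau> j, \<sigma> * H)\<close>. For either sign
  \<sigma>, \<open>lower\<close> has a leg on the axis and \<open>upper\<close> has one on the line
  \<open>y = \<sigma> * H\<close>.\<close>

definition lower :: "real \<Rightarrow> real \<Rightarrow> nat \<Rightarrow> point set" where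
  "lower \<tau> \<sigma> j = right_triangle (X \<tau> j, 0) (- \<tau> * h) (\<sigma> * H)"

definition upper :: "real \<Rightarrow> real \<Rightarrow> nat \<Rightarrow> point set" where
  "upper \<tau> \<sigma> j = right_triangle (X \<tau> (j - 1), \<sigma> * H) (\<tau> * h) (- \<sigma> * H)"

lemma lower_eq: "j \<ge> 1 \<Longrightarrow> lower \<tau> \<sigma> j = convex hull {(X \<tau> (j - 1), 0), (X \<tau> j, \<sigma> * H), (X \<tau> j, 0)}"
  unfolding lower_def right_triangle_def X_pred by (rule arg_cong[of _ _ "(hull) convex"]) auto

lemma upper_eq:
  "j \<ge> 1 \<Longrightarrow> upper \<tau> \<sigma> j = convex hull {(X \<tau> (j - 1), 0), (X \<tau> j, \<sigma> * H), (X \<tau> (j - 1), \<sigma> * H)}"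
  unfolding upper_def right_triangle_def X_pred by (rule arg_cong[of _ _ "(hull) convex"]) auto

lemma lower_upper_mem:
  assumes "\<tau> \<in> {1, -1}" "\<sigma> \<in> {1, -1}" "j \<in> {1..N}"
  shows "lower \<tau> \<sigma> j \<in> \<T>" "upper \<tau> \<sigma> j \<in> \<T>"
proof -
  have j: "1 \<le> j" "j \<le> N" using assms(3) by auto
  have s: "\<sigma> * H \<in> {H, - H}" using assms(2) by auto
  have "lower \<tau> \<sigma> j \<in> type_C \<epsilon> H N \<and> upper \<tau> \<sigma> j \<in> type_C \<epsilon> H N"
  proof (cases "\<tau> = 1")
    case True
    have X: "X \<tau> j = \<epsilon> / real N * real j" "X \<tau> (j - 1) = \<epsilon> / real N * real (j - 1)"
      using j N_pos True by (simp_all add: X_def h_def field_simps)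
    show ?thesis
      unfolding lower_eq[OF j(1)] upper_eq[OF j(1)] type_C_def Let_def X
      using s assms(3) by blast
  next
    case False
    then have t: "\<tau> = -1" using assms(1) by auto
    \<comment> \<open>In the right half \<open>X \<tau> j\<close> is grid point number
      \<open>2 * N - j\<close>, the left end of rectangle number
      \<open>2 * N + 1 - j\<close>.\<close>
    define i where "i = 2 * N + 1 - j"
    have i: "i \<in> {N + 1..2 * N}" using j by (auto simp: i_def)
    have X: "X \<tau> j = \<epsilon> / real N * real (i - 1)" "X \<tau> (j - 1) = \<epsilon> / real N * real i"
      using j N_pos t by (simp_all add: X_def h_def i_def of_nat_diff field_simps)
    show ?thesis
      unfolding lower_eq[OF j(1)] upper_eq[OF j(1)] type_C_def Let_def X
      using s i by blast
  qed
  then show "lower \<tau> \<sigma> j \<in> \<T>" "upper \<tau> \<sigma> j \<in> \<T>" using type_C by auto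
qed

text \<open>Half of the mesh, row, column, and \<open>lower\<close> (True) or \<open>upper\<close>
  (False). Half and row are real signs so that they can serve as factors in coordinates.\<close>

definition idx :: "(real \<times> real \<times> nat \<times> bool) set" where
  "idx = {1, -1} \<times> {1, -1} \<times> {1..N} \<times> UNIV"

definition tri_of :: "real \<times> real \<times> nat \<times> bool \<Rightarrow> point set" where
  "tri_of = (\<lambda>(\<tau>, \<sigma>, j, k). if k then lower \<tau> \<sigma> j else upper \<tau> \<sigma> j)"

lemma finite_idx: "finite idx"
  by (simp add: idx_def)

lemma tri_of_subset: "tri_of ` idx \<subseteq> \<T>"
  by (auto simp: idx_def tri_of_def intro!: lower_upper_mem)

text \<open>Distinct indices give distinct centroids. The second coordinate determines row and kind;
  the first then determines \<tau> as its sign relative to \<epsilon>, and \<open>j\<close> as its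
  distance from \<epsilon>.\<close>

lemma inj_tri_of: "inj_on tri_of idx"
proof -
  have cen: "(3 * \<epsilon> - \<tau> * h * (3 * (real N - real j) + (if k then 1 else 2)),
              \<sigma> * H * (if k then 1 else 2)) =
             (3 * \<epsilon> - \<tau>' * h * (3 * (real N - real j') + (if k' then 1 else 2)),
              \<sigma>' * H * (if k' then 1 else 2))"
    if A: "(\<tau>, \<sigma>, j, k) \<in> idx" "(\<tau>', \<sigma>', j', k') \<in> idx" "tri_of (\<tau>, \<sigma>, j, k) = tri_of (\<tau>', \<sigma>', j', k')"
    for \<tau> \<sigma> j k \<tau>' \<sigma>' j' k'
  proof -
    define R where "R \<tau> \<sigma> j k = (if k then (X \<tau> j, 0) else (X \<tau> (j - 1), \<sigma> * H))" for \<tau> \<sigma> j k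
    define a where "a \<tau> k = (if k then - \<tau> * h else \<tau> * h)" for \<tau> k
    define b where "b \<sigma> k = (if k then \<sigma> * H else - \<sigma> * H)" for \<sigma> k
    have T: "tri_of (\<tau>, \<sigma>, j, k) = right_triangle (R \<tau> \<sigma> j k) (a \<tau> k) (b \<sigma> k)" for \<tau> \<sigma> j k
      by (simp add: tri_of_def lower_def upper_def R_def a_def b_def)
    have ab: "a \<tau> k \<noteq> 0" "b \<sigma> k \<noteq> 0" "\<bar>a \<tau> k * b \<sigma> k\<bar> = h * H"
      if "(\<tau>, \<sigma>, j, k) \<in> idx" for \<tau> \<sigma> j k
      using that h_pos H_pos by (auto simp: idx_def a_def b_def abs_mult)
    have c: "3 *\<^sub>R R \<tau> \<sigma> j k + (a \<tau> k, b \<sigma> k) =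
        (3 * \<epsilon> - \<tau> * h * (3 * (real N - real j) + (if k then 1 else 2)), \<sigma> * H * (if k then 1 else 2))"
      if "(\<tau>, \<sigma>, j, k) \<in> idx" for \<tau> \<sigma> j k
      using that by (auto simp: idx_def R_def a_def b_def X_def of_nat_diff algebra_simps)
    show ?thesis
      using centroid_unique[OF A(3)[unfolded T] ab(1,2)[OF A(1)]] ab(3)[OF A(1)] ab(3)[OF A(2)]
        c[OF A(1)] c[OF A(2)] by simp
  qed
  show ?thesis
  proof (rule inj_onI)
    fix i i' assume i: "i \<in> idx" "i' \<in> idx" and eq: "tri_of i = tri_of i'"
    obtain \<tau> \<sigma> j k \<tau>' \<sigma>' j' k' where ii: "i = (\<tau>, \<sigma>, j, k)" "i' = (\<tau>', \<sigma>', j', k')"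
      by (metis prod_cases4)
    note c = cen[OF i(1)[unfolded ii] i(2)[unfolded ii] eq[unfolded ii], unfolded prod.inject]
    have mem: "\<tau> \<in> {1, -1}" "\<tau>' \<in> {1, -1}" "\<sigma> \<in> {1, -1}" "\<sigma>' \<in> {1, -1}" "j \<le> N" "j' \<le> N"
      using i ii by (auto simp: idx_def)
    have k: "\<sigma> = \<sigma>' \<and> k = k'"
      using c mem(3,4) H_pos by (auto split: if_splits)
    have "\<tau> * (3 * (real N - real j) + (if k then 1 else 2)) * h =
          \<tau>' * (3 * (real N - real j') + (if k then 1 else 2)) * h"
      using c k by (simp add: algebra_simps)
    then have t: "\<tau> * (3 * (real N - real j) + (if k then 1 else 2)) =
          \<tau>' * (3 * (real N - real j') + (if k then 1 else 2))"
      using h_pos by simp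
    have "\<tau> = \<tau>' \<and> j = j'"
      using mem t by (auto split: if_splits)
    then show "i = i'" using k ii by simp
  qed
qed

lemma cover: "local_domain \<epsilon> H \<subseteq> \<Union>(tri_of ` idx)"
proof
  fix z assume z: "z \<in> local_domain \<epsilon> H"
  obtain x y where xy: "z = (x, y)" by (cases z)
  have b: "0 < x" "x < 2 * \<epsilon>" "- H < y" "y < H"
    using z by (auto simp: local_domain_def xy)
  define \<tau> :: real where "\<tau> = (if x \<le> \<epsilon> then 1 else -1)"
  define \<sigma> :: real where "\<sigma> = (if 0 \<le> y then 1 else -1)"
  \<comment> \<open>\<open>r\<close> is the fractional node number of \<open>x\<close>, counted from
    the outer end of its half; \<open>t\<close> is the relative height within the row.\<close>
  define r where "r = real N - \<bar>x - \<epsilon>\<bar> / h"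
  define t where "t = \<bar>y\<bar> / H"
  have x: "x = \<epsilon> - \<tau> * (real N - r) * h" and y: "y = \<sigma> * t * H"
    using h_pos H_pos by (auto simp: r_def t_def \<tau>_def \<sigma>_def)
  have t: "0 \<le> t" "t \<le> 1" using b H_pos by (auto simp: t_def)
  have "\<bar>x - \<epsilon>\<bar> < real N * h" using b N_h by auto
  then have r: "0 < r" "r \<le> real N" using h_pos by (auto simp: r_def pos_divide_less_eq)
  define j where "j = nat \<lceil>r\<rceil>"
  have j: "real j - 1 < r" "r \<le> real j" "1 \<le> j" "j \<le> N"
    using r by (auto simp: j_def) linarith+
  have mem: "(\<tau>, \<sigma>, j, k) \<in> idx" for k
    using j by (auto simp: idx_def \<tau>_def \<sigma>_def)
  \<comment> \<open>The diagonal of the rectangle is the line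
    \<open>real j - r + t = 1\<close>.\<close>
  show "z \<in> \<Union>(tri_of ` idx)"
  proof (cases "real j - r + t \<le> 1")
    case True
    have "z \<in> lower \<tau> \<sigma> j"
      unfolding lower_def mem_right_triangle
      by (rule exI[of _ "real j - r"], rule exI[of _ t])
        (use True j t in \<open>auto simp: xy x y X_def algebra_simps\<close>)
    moreover have "lower \<tau> \<sigma> j = tri_of (\<tau>, \<sigma>, j, True)" by (simp add: tri_of_def)
    ultimately show ?thesis using mem[of True] by blast
  next
    case False
    have "z \<in> upper \<tau> \<sigma> j"
      unfolding upper_def mem_right_triangle
      by (rule exI[of _ "r - (real j - 1)"], rule exI[of _ "1 - t"])
        (use False j t in \<open>auto simp: xy x y X_def of_nat_diff algebra_simps\<close>)
    moreover have "upper \<tau> \<sigma> j = tri_of (\<tau>, \<sigma>, j, False)" by (simp add: tri_of_def)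
    ultimately show ?thesis using mem[of False] by blast
  qed
qed

text \<open>Confines the support of the test function to known triangles, however \<Omega> is
  triangulated elsewhere.\<close>

lemma meets_local_domain:
  assumes "T \<in> \<T>" "T \<inter> local_domain \<epsilon> H \<noteq> {}"
  shows "T \<in> tri_of ` idx"
proof -
  have "open (local_domain \<epsilon> H)" by (simp add: local_domain_def open_Times)
  then show ?thesis
    using triangle_meets_open[OF tri _ _ tri_of_subset cover assms] finite_idx by blast
qed

end

section \<open>Second differences of the layer function\<close>

text \<open>The difference of the two sides is
  \<open>(exp (x / 2) - exp (- x / 2))\<^sup>2 - x\<^sup>2\<close>, so the claim reduces to
  \<open>sinh y \<ge> y\<close> for nonnegative \<open>y\<close>, which follows by
  differentiation.\<close>

lemma exp_add_exp_minus_ge: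
  fixes x :: real
  shows "2 + x\<^sup>2 \<le> exp x + exp (- x)"
proof -
  have *: "2 * y \<le> exp y - exp (- y)" if "y \<ge> 0" for y :: real
  proof -
    have "exp 0 - exp (- 0) - 2 * 0 \<le> exp y - exp (- y) - 2 * y"
    proof (rule DERIV_nonneg_imp_nondecreasing[OF that])
      fix t :: real
      have "2 \<le> exp t + exp (- t)"
        using sum_power2_ge_zero[of "exp (t / 2) - exp (- t / 2)" 0]
        by (simp add: power2_eq_square algebra_simps flip: exp_add)
      then show "\<exists>d. ((\<lambda>y. exp y - exp (- y) - 2 * y) has_real_derivative d) (at t) \<and> 0 \<le> d"
        by (intro exI[of _ "exp t + exp (- t) - 2"]) (auto intro!: derivative_eq_intros)
    qed
    then show ?thesis by simp
  qed
  have "(2 * (\<bar>x\<bar> / 2))\<^sup>2 \<le> (exp (\<bar>x\<bar> / 2) - exp (- (\<bar>x\<bar> / 2)))\<^sup>2"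
    using *[of "\<bar>x\<bar> / 2"] by (intro power_mono) auto
  also have "\<dots> = exp \<bar>x\<bar> + exp (- \<bar>x\<bar>) - 2"
    by (simp add: power2_eq_square algebra_simps flip: exp_add)
  finally show ?thesis by (cases "x \<ge> 0") auto
qed

text \<open>Summation by parts: the weight \<open>j\<close> has vanishing second difference, so the
  weighted sum of second differences collapses to the boundary terms on the right.\<close>

lemma weighted_sum_le_of_second_difference:
  fixes r :: "nat \<Rightarrow> real"
  assumes "n \<ge> 1" "\<And>j. 1 \<le> j \<Longrightarrow> j < n \<Longrightarrow> c * r j \<le> r (Suc j) - 2 * r j + r (j - 1)"
  shows "c * (\<Sum>j=1..<n. real j * r j) \<le> (real n - 1) * r n - real n * r (n - 1) + r 0"
  using assms
proof (induction n rule: dec_induct)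
  case (step n)
  have "real n * (c * r n) \<le> real n * (r (Suc n) - 2 * r n + r (n - 1))"
    using step by (intro mult_left_mono) auto
  then show ?case using step by (simp add: algebra_simps)
qed simp

text \<open>Node \<open>j\<close> receives \<open>j\<close> from column \<open>j\<close> and
  \<open>2 * j\<close> from column \<open>j + 1\<close>. The last node has no further column and
  keeps one third of the regular weight.\<close>

lemma sum_column_weights:
  fixes r :: "nat \<Rightarrow> real"
  assumes "n \<ge> 1"
  shows "(\<Sum>j=1..n. real j * r j + 2 * real (j - 1) * r (j - 1)) = 3 * (\<Sum>j=1..<n. real j * r j) + real n * r n"
  using assms by (induction n rule: dec_induct) auto

lemma sum_odd: "(\<Sum>j=1..n. real j + real (j - 1)) = (real n)\<^sup>2"
  by (induction n) (auto simp: power2_eq_square algebra_simps)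

text \<open>The exact solution at the node \<open>X \<tau> j\<close>, where \<epsilon> cancels.
  Indices \<open>j > N\<close> continue beyond \<open>(\<epsilon>, 0)\<close> into the other
  half.\<close>

definition layer_val :: "nat \<Rightarrow> real \<Rightarrow> nat \<Rightarrow> real" where
  "layer_val N \<tau> j = exp (\<tau> * (real N - real j) / real N - 1)"

text \<open>Neighbouring values differ by the factors \<open>exp x\<close> and
  \<open>exp (- x)\<close> with \<open>x = \<tau> / N\<close>, so this is the bound
  \<open>exp x + exp (- x) - 2 \<ge> x\<^sup>2\<close> times the nodal value.\<close>

lemma second_difference_layer_val:
  assumes "N \<ge> 1" "j \<ge> 1" "\<tau> \<in> {1, -1}"
  shows "1 / (real N)\<^sup>2 * layer_val N \<tau> j \<le>
    layer_val N \<tau> (Suc j) - 2 * layer_val N \<tau> j + layer_val N \<tau> (j - 1)"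
proof -
  define x where "x = \<tau> / real N"
  have "layer_val N \<tau> (Suc j) = layer_val N \<tau> j * exp (- x)"
       "layer_val N \<tau> (j - 1) = layer_val N \<tau> j * exp x"
    using assms by (simp_all add: layer_val_def x_def of_nat_diff field_simps flip: exp_add)
  moreover have "layer_val N \<tau> j * (2 + x\<^sup>2) \<le> layer_val N \<tau> j * (exp x + exp (- x))"
    by (intro mult_left_mono exp_add_exp_minus_ge) (simp add: layer_val_def)
  moreover have "x\<^sup>2 = 1 / (real N)\<^sup>2"
    using assms(3) by (auto simp: x_def power_divide)
  ultimately show ?thesis by (simp add: algebra_simps)
qed

text \<open>Each half mesh gives the node \<open>(\<epsilon>, 0)\<close> one third of the regular lumped weight, so both together
  only \<open>2/3\<close>; the missing third is the left-hand side.\<close>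

lemma layer_val_balance:
  assumes "N \<ge> 1"
  shows "real N * exp (- 1) / 3 \<le>
    (\<Sum>\<tau>\<in>{1, -1}. (real N)\<^sup>2 * (layer_val N \<tau> 0 - layer_val N \<tau> N) -
      (\<Sum>j=1..N. real j * layer_val N \<tau> j + 2 * real (j - 1) * layer_val N \<tau> (j - 1)) / 3)"
proof -
  let ?r = "layer_val N"
  have e: "?r \<tau> N = exp (- 1)" for \<tau> by (simp add: layer_val_def)
  define D where "D \<tau> = (real N)\<^sup>2 * (?r \<tau> 0 - ?r \<tau> N) -
      (\<Sum>j=1..N. real j * ?r \<tau> j + 2 * real (j - 1) * ?r \<tau> (j - 1)) / 3" for \<tau>
  have side: "(real N) ^ 3 * (?r \<tau> (N - 1) - exp (- 1)) - real N * exp (- 1) / 3 \<le> D \<tau>"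
    if "\<tau> \<in> {1, -1}" for \<tau>
  proof -
    have "1 / (real N)\<^sup>2 * (\<Sum>j=1..<N. real j * ?r \<tau> j) \<le>
        (real N - 1) * ?r \<tau> N - real N * ?r \<tau> (N - 1) + ?r \<tau> 0"
      using second_difference_layer_val[OF assms _ that] assms
      by (intro weighted_sum_le_of_second_difference) auto
    then have "(\<Sum>j=1..<N. real j * ?r \<tau> j) \<le>
        (real N)\<^sup>2 * ((real N - 1) * ?r \<tau> N - real N * ?r \<tau> (N - 1) + ?r \<tau> 0)"
      using assms by (simp add: field_simps)
    then show ?thesis
      unfolding D_def sum_column_weights[OF assms] e
      by (simp add: algebra_simps add_divide_distrib power2_eq_square power3_eq_cube)
  qed
  \<comment> \<open>The right-hand neighbour of \<open>(\<epsilon>, 0)\<close> continues the left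
    half, so the boundary terms of the two halves combine into the second difference at that
    node.\<close>
  have sym: "?r (-1) (N - 1) = ?r 1 (Suc N)"
    using assms by (simp add: layer_val_def of_nat_diff field_simps)
  have "1 / (real N)\<^sup>2 * exp (- 1) \<le> ?r 1 (N - 1) + ?r (-1) (N - 1) - 2 * exp (- 1)"
    using second_difference_layer_val[OF assms assms, of 1] unfolding e sym by simp
  \<comment> \<open>The second difference yields \<open>N * exp (- 1)\<close>; the two halves
    consume one third of this each in \<open>side\<close>, and one third remains.\<close>
  then have "(real N) ^ 3 * (1 / (real N)\<^sup>2 * exp (- 1)) \<le>
      (real N) ^ 3 * (?r 1 (N - 1) + ?r (-1) (N - 1) - 2 * exp (- 1))"
    by (intro mult_left_mono) auto
  moreover have "(real N) ^ 3 * (1 / (real N)\<^sup>2 * exp (- 1)) = real N * exp (- 1)"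
    using assms by (simp add: power2_eq_square power3_eq_cube)
  ultimately have "real N * exp (- 1) / 3 \<le> D 1 + D (-1)"
    using side[of 1] side[of "-1"] by (simp add: algebra_simps)
  then show ?thesis by (simp add: D_def)
qed

section \<open>The test function\<close>

lemma fe_space_right_triangle:
  assumes "w \<in> fe_space \<T>" "right_triangle R a b \<in> \<T>" "0 \<le> s" "0 \<le> t" "s + t \<le> 1"
  shows "w (fst R + s * a, snd R + t * b) = (1 - s - t) * w R + s * w (R + (a, 0)) + t * w (R + (0, b))"
proof -
  obtain d c where w: "\<And>z. z \<in> right_triangle R a b \<Longrightarrow> w z = d \<bullet> z + c"
    using assms(1,2) by (auto simp: fe_space_def)
  have "(fst R + s * a, snd R + t * b) \<in> right_triangle R a b"
    using assms(3-5) by (auto simp: mem_right_triangle)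
  then show ?thesis
    using mem_right_triangle_corners[where R = R and a = a and b = b]
    by (simp add: w inner_prod_def algebra_simps)
qed

locale layer_solution = layer_mesh +
  fixes U :: "point \<Rightarrow> real"
  assumes sol: "lumped_mass_solution \<Omega> \<T> (layer_f \<epsilon>) (layer_u \<epsilon>) U"
begin

lemma U_fe: "U \<in> fe_space \<T>"
  using sol by (simp add: lumped_mass_solution_def)

text \<open>On the axis \<open>tent\<close> is the discrete Green's function of the second difference (up to
  scaling) with pole at the defective node \<open>(\<epsilon>, 0)\<close>.\<close>

definition tent :: "point \<Rightarrow> real" where
  "tent z = (if z \<in> local_domain \<epsilon> H then min (fst z) (2 * \<epsilon> - fst z) / h else 0)"

text \<open>\<open>tent\<close> does not depend on \<open>y\<close> inside the local domain and
  jumps at its horizontal sides, so it is no mesh function; only its values at vertices are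
  used.\<close>

definition test :: "point \<Rightarrow> real" where
  "test = interpolant \<T> tent"

lemma test_fe: "test \<in> fe_space \<T>" and test_vertex: "p \<in> vertices \<T> \<Longrightarrow> test p = tent p"
  unfolding test_def by (rule interpolant_fe_space[OF tri], rule interpolant_vertex[OF tri])

definition load :: "point \<Rightarrow> real" where
  "load = interpolant \<T> (\<lambda>z. layer_f \<epsilon> z * test z)"

lemma load_fe: "load \<in> fe_space \<T>"
  and load_vertex: "p \<in> vertices \<T> \<Longrightarrow> load p = layer_f \<epsilon> p * test p"
  unfolding load_def by (rule interpolant_fe_space[OF tri], rule interpolant_vertex[OF tri])

text \<open>A triangle outside the local mesh does not meet the local domain, so \<open>tent\<close>
  vanishes at its vertices.\<close>

lemma vertex_not_local:
  assumes "T \<in> \<T>" "T \<notin> tri_of ` idx" "q extreme_point_of T"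
  shows "q \<in> vertices \<T>" "test q = 0"
proof -
  show "q \<in> vertices \<T>" using assms by (auto simp: vertices_def)
  have "q \<in> T" using assms(3) by (simp add: extreme_point_of_def)
  then have "q \<notin> local_domain \<epsilon> H" using meets_local_domain assms(1,2) by blast
  then show "test q = 0" using test_vertex[OF \<open>q \<in> vertices \<T>\<close>] by (simp add: tent_def)
qed

lemma test_eq_0:
  assumes "T \<in> \<T>" "T \<notin> tri_of ` idx" "z \<in> T"
  shows "test z = 0"
  by (rule fe_space_eq_0[OF tri test_fe assms(1) _ assms(3)]) (rule vertex_not_local(2)[OF assms(1,2)])

lemma load_eq_0:
  assumes "T \<in> \<T>" "T \<notin> tri_of ` idx" "z \<in> T"
  shows "load z = 0"
  by (rule fe_space_eq_0[OF tri load_fe assms(1) _ assms(3)])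
    (simp add: load_vertex vertex_not_local[OF assms(1,2)])

lemma mem_local_domain: "(x, y) \<in> local_domain \<epsilon> H \<longleftrightarrow> \<bar>x - \<epsilon>\<bar> < \<epsilon> \<and> \<bar>y\<bar> < H"
  by (auto simp: local_domain_def)

text \<open>The outer node \<open>j = 0\<close> is included: it lies outside the open local domain,
  where \<open>tent\<close> is \<open>0\<close> by definition.\<close>

lemma tent_axis:
  assumes "\<tau> \<in> {1, -1}" "j \<le> N"
  shows "tent (X \<tau> j, 0) = real j"
proof -
  have "\<bar>X \<tau> j - \<epsilon>\<bar> = (real N - real j) * h"
    using assms h_pos by (auto simp: X_def abs_mult)
  then have "(X \<tau> j, 0) \<in> local_domain \<epsilon> H \<longleftrightarrow> (real N - real j) * h < real N * h"
    by (simp add: mem_local_domain H_pos N_h)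
  then have "(X \<tau> j, 0) \<in> local_domain \<epsilon> H \<longleftrightarrow> 0 < j"
    using h_pos by (auto simp: mult_less_cancel_right)
  moreover have "min (X \<tau> j) (2 * \<epsilon> - X \<tau> j) = real j * h"
  proof -
    have "0 \<le> (real N - real j) * h" using assms h_pos by auto
    then show ?thesis
      using assms(1) N_h by (auto simp: X_def min_def algebra_simps)
  qed
  ultimately show ?thesis using h_pos by (auto simp: tent_def)
qed

lemma tent_off_axis: "\<sigma> \<in> {1, -1} \<Longrightarrow> tent (x, \<sigma> * H) = 0"
  using H_pos by (auto simp: tent_def mem_local_domain)

lemma node_vertices:
  assumes "\<tau> \<in> {1, -1}" "\<sigma> \<in> {1, -1}" "j \<in> {1..N}"
  shows "(X \<tau> j, 0) \<in> vertices \<T>" "(X \<tau> (j - 1), 0) \<in> vertices \<T>"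
    "(X \<tau> j, \<sigma> * H) \<in> vertices \<T>" "(X \<tau> (j - 1), \<sigma> * H) \<in> vertices \<T>"
proof -
  note mem = lower_upper_mem[OF assms]
  have j: "1 \<le> j" using assms(3) by simp
  note X = X_pred[OF j, of \<tau>]
  have "p \<in> vertices \<T>"
    if "p \<in> {(X \<tau> j, 0), (X \<tau> j, 0) + (- \<tau> * h, 0), (X \<tau> j, 0) + (0, \<sigma> * H)}" for p
    using extreme_point_of_right_triangle[OF tri mem(1)[unfolded lower_def], of p] that mem(1)
    unfolding vertices_def lower_def by blast
  then show "(X \<tau> j, 0) \<in> vertices \<T>" "(X \<tau> (j - 1), 0) \<in> vertices \<T>" "(X \<tau> j, \<sigma> * H) \<in> vertices \<T>"
    unfolding X by auto
  have "(X \<tau> (j - 1), \<sigma> * H) extreme_point_of upper \<tau> \<sigma> j"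
    using extreme_point_of_right_triangle[OF tri mem(2)[unfolded upper_def]] unfolding upper_def by blast
  then show "(X \<tau> (j - 1), \<sigma> * H) \<in> vertices \<T>"
    using mem(2) by (auto simp: vertices_def)
qed

lemma test_nodes:
  assumes "\<tau> \<in> {1, -1}" "\<sigma> \<in> {1, -1}" "j \<in> {1..N}"
  shows "test (X \<tau> j, 0) = real j" "test (X \<tau> (j - 1), 0) = real (j - 1)"
    "test (X \<tau> j, \<sigma> * H) = 0" "test (X \<tau> (j - 1), \<sigma> * H) = 0"
proof -
  have "j \<le> N" "j - 1 \<le> N" using assms(3) by auto
  then show "test (X \<tau> j, 0) = real j" "test (X \<tau> (j - 1), 0) = real (j - 1)"
    "test (X \<tau> j, \<sigma> * H) = 0" "test (X \<tau> (j - 1), \<sigma> * H) = 0"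
    using node_vertices[OF assms] tent_axis[OF assms(1)] tent_off_axis[OF assms(2)]
    by (simp_all only: test_vertex)
qed

text \<open>Makes \<open>test\<close> admissible in the discrete problem. The local rectangle may
  touch the frontier, so it is shown that a point with nonzero \<open>test\<close> lies strictly
  inside the rectangle: it belongs to a local triangle, and its barycentric coordinates keep it off
  the sides.\<close>

lemma test_frontier:
  assumes "z \<in> frontier \<Omega>"
  shows "test z = 0"
proof (rule ccontr)
  assume nz: "test z \<noteq> 0"
  have "open \<Omega>" using domain by (simp add: polygonal_domain_def)
  then have z_notin: "z \<notin> local_domain \<epsilon> H"
    using assms local_subset by (auto simp: frontier_def interior_open)
  obtain T where T: "T \<in> \<T>" "z \<in> T"
    using assms triangulation_Union[OF tri] by (auto simp: frontier_def)
  then have "T \<in> tri_of ` idx" using nz test_eq_0 by blast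
  then obtain i where "i \<in> idx" "T = tri_of i" by blast
  moreover obtain \<tau> \<sigma> j k where "i = (\<tau>, \<sigma>, j, k)" by (cases i)
  ultimately have "(\<tau>, \<sigma>, j, k) \<in> idx" "T = tri_of (\<tau>, \<sigma>, j, k)" by auto
  then have i: "\<tau> \<in> {1, -1}" "\<sigma> \<in> {1, -1}" "j \<in> {1..N}"
    and T_eq: "T = lower \<tau> \<sigma> j \<or> T = upper \<tau> \<sigma> j"
    by (auto simp: idx_def tri_of_def)
  have j: "1 \<le> j" "j \<le> N" using i(3) by auto
  note X = X_pred[OF j(1), of \<tau>]
  note nodes = test_nodes[OF i]
  from T_eq have "z \<in> local_domain \<epsilon> H"
  proof
    assume A: "T = lower \<tau> \<sigma> j"
    then obtain s t where st: "0 \<le> s" "0 \<le> t" "s + t \<le> 1" "z = (X \<tau> j + s * (- \<tau> * h), t * (\<sigma> * H))"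
      using T by (auto simp: lower_def mem_right_triangle)
    have "test z = (1 - s - t) * test (X \<tau> j, 0) + s * test ((X \<tau> j, 0) + (- \<tau> * h, 0)) +
        t * test ((X \<tau> j, 0) + (0, \<sigma> * H))"
      using fe_space_right_triangle[OF test_fe _ st(1-3), of "(X \<tau> j, 0)" "- \<tau> * h" "\<sigma> * H"] T A
      by (simp add: lower_def st(4))
    then have tz: "test z = (1 - s - t) * real j + s * (real j - 1)"
      using nodes X j by (simp add: of_nat_diff)
    have t: "t < 1" using nz tz st(1-3) by (cases "t = 1") auto
    \<comment> \<open>Equality is possible only for \<open>j = 1\<close> and \<open>s = 1\<close>,
      the outer axis node, where \<open>test\<close> vanishes.\<close>
    have s: "s < real j"
    proof (rule ccontr)
      assume "\<not> s < real j"
      then have "j = 1 \<and> s = 1" using st(1-3) j by auto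
      then show False using nz tz st(1-3) by auto
    qed
    have "\<bar>X \<tau> j + s * (- \<tau> * h) - \<epsilon>\<bar> = (real N - real j + s) * h"
    proof -
      have "X \<tau> j + s * (- \<tau> * h) - \<epsilon> = - \<tau> * ((real N - real j + s) * h)"
        by (simp add: X_def algebra_simps)
      moreover have "0 \<le> (real N - real j + s) * h" using j st(1) h_pos by simp
      ultimately show ?thesis using i(1) by auto
    qed
    also have "\<dots> < real N * h" using s h_pos by simp
    finally have "\<bar>X \<tau> j + s * (- \<tau> * h) - \<epsilon>\<bar> < \<epsilon>" by (simp add: N_h)
    moreover have "\<bar>t * (\<sigma> * H)\<bar> < H" using i(2) t st(2) H_pos by (auto simp: abs_mult)
    ultimately show ?thesis by (simp add: st(4) mem_local_domain)
  next
    assume A: "T = upper \<tau> \<sigma> j"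
    then obtain s t where st: "0 \<le> s" "0 \<le> t" "s + t \<le> 1"
        "z = (X \<tau> (j - 1) + s * (\<tau> * h), \<sigma> * H + t * (- \<sigma> * H))"
      using T by (auto simp: upper_def mem_right_triangle)
    have "test z = (1 - s - t) * test (X \<tau> (j - 1), \<sigma> * H) + s * test ((X \<tau> (j - 1), \<sigma> * H) + (\<tau> * h, 0)) +
        t * test ((X \<tau> (j - 1), \<sigma> * H) + (0, - \<sigma> * H))"
      using fe_space_right_triangle[OF test_fe _ st(1-3), of "(X \<tau> (j - 1), \<sigma> * H)" "\<tau> * h" "- \<sigma> * H"] T A
      by (simp add: upper_def st(4))
    then have tz: "test z = t * (real j - 1)"
      using nodes X j by (simp add: of_nat_diff)
    \<comment> \<open>The only corner on the axis is node \<open>j - 1\<close>, so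
      \<open>test\<close> vanishes on the whole triangle if \<open>j = 1\<close>.\<close>
    then have t: "0 < t" "2 \<le> j" using nz st(2) j by (auto simp: less_le)
    have "\<bar>X \<tau> (j - 1) + s * (\<tau> * h) - \<epsilon>\<bar> = (real N - real j + 1 - s) * h"
    proof -
      have "X \<tau> (j - 1) + s * (\<tau> * h) - \<epsilon> = - \<tau> * ((real N - real j + 1 - s) * h)"
        using j by (simp add: X_def of_nat_diff algebra_simps)
      moreover have "0 \<le> (real N - real j + 1 - s) * h" using j st(1-3) h_pos by simp
      ultimately show ?thesis using i(1) by auto
    qed
    also have "\<dots> < real N * h" using st(1) t(2) h_pos by simp
    finally have "\<bar>X \<tau> (j - 1) + s * (\<tau> * h) - \<epsilon>\<bar> < \<epsilon>" by (simp add: N_h)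
    moreover have "\<bar>\<sigma> * H + t * (- \<sigma> * H)\<bar> < H"
    proof -
      have "\<sigma> * H + t * (- \<sigma> * H) = \<sigma> * ((1 - t) * H)" by (simp add: algebra_simps)
      moreover have "0 \<le> (1 - t) * H" "(1 - t) * H < H" using t st(1-3) H_pos by auto
      ultimately show ?thesis using i(2) by auto
    qed
    ultimately show ?thesis by (simp add: st(4) mem_local_domain)
  qed
  then show False using z_notin by simp
qed

end

section \<open>The discrete balance and the error bound\<close>

context layer_solution
begin

text \<open>Triangle integrals of \<open>grad U \<bullet> grad test\<close>. Along the axis
  \<open>test\<close> changes by one per cell; \<open>upper\<close> has no horizontal term because
  \<open>test\<close> vanishes at both ends of its horizontal leg.\<close>

definition stiffness :: "real \<times> real \<times> nat \<times> bool \<Rightarrow> real" where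
  "stiffness = (\<lambda>(\<tau>, \<sigma>, j, k).
     if k then h * H / 2 * ((U (X \<tau> j, 0) - U (X \<tau> (j - 1), 0)) / h\<^sup>2 +
                            real j * (U (X \<tau> j, 0) - U (X \<tau> j, \<sigma> * H)) / H\<^sup>2)
     else h * H / 2 * (real (j - 1) * (U (X \<tau> (j - 1), 0) - U (X \<tau> (j - 1), \<sigma> * H)) / H\<^sup>2))"

text \<open>Triangle integrals of \<open>load\<close> by the vertex rule: only corners on the axis
  count, two for \<open>lower\<close> and one for \<open>upper\<close>.\<close>

definition lumped :: "real \<times> real \<times> nat \<times> bool \<Rightarrow> real" where
  "lumped = (\<lambda>(\<tau>, \<sigma>, j, k).
     if k then h * H / 6 * (real j * layer_f \<epsilon> (X \<tau> j, 0) +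
                            real (j - 1) * layer_f \<epsilon> (X \<tau> (j - 1), 0))
     else h * H / 6 * (real (j - 1) * layer_f \<epsilon> (X \<tau> (j - 1), 0)))"

lemma has_integral_stiffness:
  assumes "i \<in> idx"
  shows "((\<lambda>z. grad U z \<bullet> grad test z) has_integral stiffness i) (tri_of i)"
proof -
  obtain \<tau> \<sigma> j k where i: "i = (\<tau>, \<sigma>, j, k)" by (cases i)
  have i': "\<tau> \<in> {1, -1}" "\<sigma> \<in> {1, -1}" "j \<in> {1..N}" using assms by (auto simp: i idx_def)
  have j: "1 \<le> j" using i'(3) by simp
  note X = X_pred[OF j, of \<tau>]
  have nz: "- \<tau> * h \<noteq> 0" "\<sigma> * H \<noteq> 0" "\<tau> * h \<noteq> 0" "- \<sigma> * H \<noteq> 0"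
    using i' h_pos H_pos by auto
  have sq: "(\<tau> * h)\<^sup>2 = h\<^sup>2" "(\<sigma> * H)\<^sup>2 = H\<^sup>2" "\<bar>\<tau> * h * (\<sigma> * H)\<bar> = h * H"
    using i' h_pos H_pos by (auto simp: abs_mult power_mult_distrib)
  note mem = lower_upper_mem[OF i']
  note nodes = test_nodes[OF i']
  show ?thesis
  proof (cases k)
    case True
    have "(X \<tau> j, 0) + (- \<tau> * h, 0) = (X \<tau> (j - 1), 0 :: real)" "(X \<tau> j, 0) + (0, \<sigma> * H) = (X \<tau> j, \<sigma> * H)"
      by (simp_all add: X del: One_nat_def)
    from has_integral_grad_inner_right_triangle[OF tri U_fe test_fe mem(1)[unfolded lower_def] nz(1,2),
        unfolded this nodes]
    have "((\<lambda>z. grad U z \<bullet> grad test z) has_integral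
       h * H / 2 * ((U (X \<tau> (j - 1), 0) - U (X \<tau> j, 0)) * (real (j - 1) - real j) / h\<^sup>2 +
           (U (X \<tau> j, \<sigma> * H) - U (X \<tau> j, 0)) * (0 - real j) / H\<^sup>2)) (lower \<tau> \<sigma> j)"
      using sq by (simp add: lower_def)
    also have "h * H / 2 * ((U (X \<tau> (j - 1), 0) - U (X \<tau> j, 0)) * (real (j - 1) - real j) / h\<^sup>2 +
           (U (X \<tau> j, \<sigma> * H) - U (X \<tau> j, 0)) * (0 - real j) / H\<^sup>2) = stiffness i"
      using j True by (simp add: stiffness_def i of_nat_diff algebra_simps)
    finally show ?thesis using True by (simp add: i tri_of_def)
  next
    case False
    have "(X \<tau> (j - 1), \<sigma> * H) + (\<tau> * h, 0) = (X \<tau> j, \<sigma> * H)"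
        "(X \<tau> (j - 1), \<sigma> * H) + (0, - \<sigma> * H) = (X \<tau> (j - 1), 0)"
      by (simp_all add: X del: One_nat_def)
    from has_integral_grad_inner_right_triangle[OF tri U_fe test_fe mem(2)[unfolded upper_def] nz(3,4),
        unfolded this nodes]
    have "((\<lambda>z. grad U z \<bullet> grad test z) has_integral
       h * H / 2 * ((U (X \<tau> j, \<sigma> * H) - U (X \<tau> (j - 1), \<sigma> * H)) * (0 - 0) / h\<^sup>2 +
           (U (X \<tau> (j - 1), 0) - U (X \<tau> (j - 1), \<sigma> * H)) * (real (j - 1) - 0) / H\<^sup>2)) (upper \<tau> \<sigma> j)"
      using sq by (simp add: upper_def)
    also have "h * H / 2 * ((U (X \<tau> j, \<sigma> * H) - U (X \<tau> (j - 1), \<sigma> * H)) * (0 - 0) / h\<^sup>2 +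
           (U (X \<tau> (j - 1), 0) - U (X \<tau> (j - 1), \<sigma> * H)) * (real (j - 1) - 0) / H\<^sup>2) = stiffness i"
      using False by (simp add: stiffness_def i)
    finally show ?thesis using False by (simp add: i tri_of_def)
  qed
qed

lemma has_integral_lumped:
  assumes "i \<in> idx"
  shows "(load has_integral lumped i) (tri_of i)"
proof -
  obtain \<tau> \<sigma> j k where i: "i = (\<tau>, \<sigma>, j, k)" by (cases i)
  have i': "\<tau> \<in> {1, -1}" "\<sigma> \<in> {1, -1}" "j \<in> {1..N}" using assms by (auto simp: i idx_def)
  have j: "1 \<le> j" using i'(3) by simp
  note X = X_pred[OF j, of \<tau>]
  have nz: "- \<tau> * h \<noteq> 0" "\<sigma> * H \<noteq> 0" "\<tau> * h \<noteq> 0" "- \<sigma> * H \<noteq> 0"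
    using i' h_pos H_pos by auto
  have sq: "\<bar>\<tau> * h * (\<sigma> * H)\<bar> = h * H"
    using i' h_pos H_pos by (auto simp: abs_mult)
  note mem = lower_upper_mem[OF i']
  note nodes = test_nodes[OF i']
  note load = node_vertices[OF i', THEN load_vertex, unfolded nodes]
  show ?thesis
  proof (cases k)
    case True
    have "(X \<tau> j, 0) + (- \<tau> * h, 0) = (X \<tau> (j - 1), 0 :: real)" "(X \<tau> j, 0) + (0, \<sigma> * H) = (X \<tau> j, \<sigma> * H)"
      by (simp_all add: X del: One_nat_def)
    from has_integral_fe_space_right_triangle[OF load_fe mem(1)[unfolded lower_def] nz(1,2),
        unfolded this load]
    have "(load has_integral h * H / 6 * (layer_f \<epsilon> (X \<tau> j, 0) * real j +
       layer_f \<epsilon> (X \<tau> (j - 1), 0) * real (j - 1) + layer_f \<epsilon> (X \<tau> j, \<sigma> * H) * 0)) (lower \<tau> \<sigma> j)"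
      using sq by (simp add: lower_def)
    then show ?thesis using True by (simp add: i tri_of_def lumped_def mult.commute)
  next
    case False
    have "(X \<tau> (j - 1), \<sigma> * H) + (\<tau> * h, 0) = (X \<tau> j, \<sigma> * H)"
        "(X \<tau> (j - 1), \<sigma> * H) + (0, - \<sigma> * H) = (X \<tau> (j - 1), 0)"
      by (simp_all add: X del: One_nat_def)
    from has_integral_fe_space_right_triangle[OF load_fe mem(2)[unfolded upper_def] nz(3,4),
        unfolded this load]
    have "(load has_integral h * H / 6 * (layer_f \<epsilon> (X \<tau> (j - 1), \<sigma> * H) * 0 +
       layer_f \<epsilon> (X \<tau> j, \<sigma> * H) * 0 + layer_f \<epsilon> (X \<tau> (j - 1), 0) * real (j - 1))) (upper \<tau> \<sigma> j)"
      using sq by (simp add: upper_def)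
    then show ?thesis using False by (simp add: i tri_of_def lumped_def mult.commute)
  qed
qed

text \<open>The discrete equation tested with \<open>test\<close>, evaluated triangle by
  triangle.\<close>

lemma sum_stiffness_eq_sum_lumped: "sum stiffness idx = sum lumped idx"
proof -
  note neg = negligible_frontier_polygonal_domain[OF domain]
  have "sum stiffness idx = integral \<Omega> (\<lambda>z. grad U z \<bullet> grad test z)"
    using has_integral_grad_inner_zero[OF tri] test_eq_0
    by (intro integral_eq_sum_triangles[OF tri neg finite_idx inj_tri_of tri_of_subset
          has_integral_stiffness, symmetric]) auto
  also have "\<dots> = integral \<Omega> load"
    using sol test_fe test_frontier unfolding load_def lumped_mass_solution_def by blast
  also have "\<dots> = sum lumped idx"
  proof (rule integral_eq_sum_triangles[OF tri neg finite_idx inj_tri_of tri_of_subset has_integral_lumped])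
    show "(load has_integral 0) T" if "T \<in> \<T>" "T \<notin> tri_of ` idx" for T
      using load_eq_0[OF that] by (rule has_integral_is_0)
  qed
  finally show ?thesis .
qed

lemma sum_idx:
  fixes c :: "real \<times> real \<times> nat \<times> bool \<Rightarrow> real"
  shows "sum c idx = (\<Sum>\<tau>\<in>{1, -1}. \<Sum>\<sigma>\<in>{1, -1}. \<Sum>j=1..N. c (\<tau>, \<sigma>, j, True) + c (\<tau>, \<sigma>, j, False))"
proof -
  have prod: "sum f (A \<times> B) = (\<Sum>a\<in>A. \<Sum>b\<in>B. f (a, b))" for f :: "'a \<times> 'b \<Rightarrow> real" and A B
    by (simp add: sum.cartesian_product)
  have "(\<Sum>k\<in>UNIV. f k) = f True + f False" for f :: "bool \<Rightarrow> real"
    by (simp add: UNIV_bool)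
  then show ?thesis by (simp only: idx_def prod)
qed

lemma layer_u_nodes: "layer_u \<epsilon> (X \<tau> j, y) = layer_val N \<tau> j"
  using eps_pos N_pos by (simp add: layer_u_def X_def layer_val_def h_def field_simps)

lemma layer_f_nodes: "layer_f \<epsilon> (X \<tau> j, y) = - layer_val N \<tau> j / \<epsilon>\<^sup>2"
  using layer_u_nodes[of \<tau> j y] by (simp add: layer_f_def layer_u_def)

text \<open>Replacing \<open>U\<close> by the exact nodal values costs, for each half,
  \<open>2 * M * N\<^sup>2\<close> in the axial terms and
  \<open>2 * M * N\<^sup>2 * (\<epsilon> / H)\<^sup>2\<close> in the vertical ones. The exact values
  leave at least the defect of \<open>layer_val_balance\<close>.\<close>

lemma error_lower_bound:
  assumes M: "\<And>p. p \<in> vertices \<T> \<Longrightarrow> \<bar>U p - layer_u \<epsilon> p\<bar> \<le> M"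
  shows "exp (- 1) / 3 \<le> 4 * M * real N * (1 + (\<epsilon> / H)\<^sup>2)"
proof -
  let ?r = "layer_val N"
  define P where "P \<tau> = (\<Sum>j=1..N. real j * ?r \<tau> j + 2 * real (j - 1) * ?r \<tau> (j - 1))" for \<tau>
  have node: "\<bar>U (X \<tau> j, 0) - ?r \<tau> j\<bar> \<le> M" "\<bar>U (X \<tau> (j - 1), 0) - ?r \<tau> (j - 1)\<bar> \<le> M"
    "\<bar>U (X \<tau> j, \<sigma> * H) - ?r \<tau> j\<bar> \<le> M" "\<bar>U (X \<tau> (j - 1), \<sigma> * H) - ?r \<tau> (j - 1)\<bar> \<le> M"
    if "\<tau> \<in> {1, -1}" "\<sigma> \<in> {1, -1}" "j \<in> {1..N}" for \<tau> \<sigma> j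
    using node_vertices[OF that, THEN M] by (simp_all only: layer_u_nodes)
  have U_ends: "U (X \<tau> N, 0) - U (X \<tau> 0, 0) \<le> ?r \<tau> N - ?r \<tau> 0 + 2 * M" if "\<tau> \<in> {1, -1}" for \<tau>
    using node(1)[OF that _, of 1 N] node(2)[OF that _, of 1 1] N_pos by simp
  have "(\<Sum>j=1..N. stiffness (\<tau>, \<sigma>, j, True) + stiffness (\<tau>, \<sigma>, j, False))
      \<le> h * H / 2 * ((?r \<tau> N - ?r \<tau> 0 + 2 * M) / h\<^sup>2 + 2 * M * (real N)\<^sup>2 / H\<^sup>2)"
    if t: "\<tau> \<in> {1, -1}" "\<sigma> \<in> {1, -1}" for \<tau> \<sigma>
  proof -
    have "stiffness (\<tau>, \<sigma>, j, True) + stiffness (\<tau>, \<sigma>, j, False) \<le>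
        h * H / 2 * ((U (X \<tau> j, 0) - U (X \<tau> (j - 1), 0)) / h\<^sup>2 + 2 * M / H\<^sup>2 * (real j + real (j - 1)))"
      if j: "j \<in> {1..N}" for j
    proof -
      \<comment> \<open>The exact solution does not depend on \<open>y\<close>, so a vertical
        difference of \<open>U\<close> consists of errors only.\<close>
      have "real j * (U (X \<tau> j, 0) - U (X \<tau> j, \<sigma> * H)) / H\<^sup>2 \<le> real j * (2 * M) / H\<^sup>2"
        using node(1,3)[OF t j] by (intro divide_right_mono mult_left_mono) auto
      moreover have "real (j - 1) * (U (X \<tau> (j - 1), 0) - U (X \<tau> (j - 1), \<sigma> * H)) / H\<^sup>2
          \<le> real (j - 1) * (2 * M) / H\<^sup>2"
        using node(2,4)[OF t j] by (intro divide_right_mono mult_left_mono) auto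
      ultimately have "(U (X \<tau> j, 0) - U (X \<tau> (j - 1), 0)) / h\<^sup>2 +
          real j * (U (X \<tau> j, 0) - U (X \<tau> j, \<sigma> * H)) / H\<^sup>2 +
          real (j - 1) * (U (X \<tau> (j - 1), 0) - U (X \<tau> (j - 1), \<sigma> * H)) / H\<^sup>2 \<le>
          (U (X \<tau> j, 0) - U (X \<tau> (j - 1), 0)) / h\<^sup>2 + 2 * M / H\<^sup>2 * (real j + real (j - 1))"
        by (simp add: add_divide_distrib distrib_left mult.commute mult.left_commute)
      then have "h * H / 2 * ((U (X \<tau> j, 0) - U (X \<tau> (j - 1), 0)) / h\<^sup>2 +
          real j * (U (X \<tau> j, 0) - U (X \<tau> j, \<sigma> * H)) / H\<^sup>2 +
          real (j - 1) * (U (X \<tau> (j - 1), 0) - U (X \<tau> (j - 1), \<sigma> * H)) / H\<^sup>2) \<le> h * H / 2 *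
          ((U (X \<tau> j, 0) - U (X \<tau> (j - 1), 0)) / h\<^sup>2 + 2 * M / H\<^sup>2 * (real j + real (j - 1)))"
        by (rule mult_left_mono) (use h_pos H_pos in simp)
      then show ?thesis by (simp add: stiffness_def distrib_left)
    qed
    then have "(\<Sum>j=1..N. stiffness (\<tau>, \<sigma>, j, True) + stiffness (\<tau>, \<sigma>, j, False)) \<le>
        (\<Sum>j=1..N. h * H / 2 * ((U (X \<tau> j, 0) - U (X \<tau> (j - 1), 0)) / h\<^sup>2 + 2 * M / H\<^sup>2 * (real j + real (j - 1))))"
      by (rule sum_mono)
    also have "\<dots> = h * H / 2 * ((\<Sum>j=1..N. U (X \<tau> j, 0) - U (X \<tau> (j - 1), 0)) / h\<^sup>2 +
        2 * M / H\<^sup>2 * (\<Sum>j=1..N. real j + real (j - 1)))"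
      by (subst sum_distrib_left[symmetric], subst sum.distrib, subst sum_distrib_left[symmetric],
          subst sum_divide_distrib) (rule refl)
    \<comment> \<open>\<open>test\<close> has constant slope on each half of the axis, so the axial
      differences telescope and only two nodal errors enter.\<close>
    also have "(\<Sum>j=1..N. U (X \<tau> j, 0) - U (X \<tau> (j - 1), 0)) = U (X \<tau> N, 0) - U (X \<tau> 0, 0)"
      using sum_telescope''[of 0 N "\<lambda>j. U (X \<tau> j, 0)"] by simp
    also have "h * H / 2 * ((U (X \<tau> N, 0) - U (X \<tau> 0, 0)) / h\<^sup>2 +
        2 * M / H\<^sup>2 * (\<Sum>j=1..N. real j + real (j - 1))) \<le>
        h * H / 2 * ((?r \<tau> N - ?r \<tau> 0 + 2 * M) / h\<^sup>2 + 2 * M / H\<^sup>2 * (\<Sum>j=1..N. real j + real (j - 1)))"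
      using U_ends[OF t(1)] h_pos H_pos by (intro mult_left_mono add_right_mono divide_right_mono) auto
    finally show ?thesis unfolding sum_odd by simp
  qed
  then have "sum stiffness idx \<le> (\<Sum>\<tau>\<in>{1, -1}. \<Sum>\<sigma>\<in>{1, -1::real}.
      h * H / 2 * ((?r \<tau> N - ?r \<tau> 0 + 2 * M) / h\<^sup>2 + 2 * M * (real N)\<^sup>2 / H\<^sup>2))"
    unfolding sum_idx by (intro sum_mono) blast
  also have "\<dots> = h * H * (\<Sum>\<tau>\<in>{1, -1}. (?r \<tau> N - ?r \<tau> 0 + 2 * M) / h\<^sup>2 + 2 * M * (real N)\<^sup>2 / H\<^sup>2)"
    by (simp add: algebra_simps)
  finally have upper_bd: "sum stiffness idx \<le>
    h * H * (\<Sum>\<tau>\<in>{1, -1}. (?r \<tau> N - ?r \<tau> 0 + 2 * M) / h\<^sup>2 + 2 * M * (real N)\<^sup>2 / H\<^sup>2)" .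
  \<comment> \<open>The right-hand side does not depend on \<sigma>; summing over both rows turns
    the factor \<open>1 / 6\<close> into \<open>1 / 3\<close>.\<close>
  have "(\<Sum>j=1..N. lumped (\<tau>, \<sigma>, j, True) + lumped (\<tau>, \<sigma>, j, False)) = - (h * H / (6 * \<epsilon>\<^sup>2)) * P \<tau>" for \<tau> \<sigma>
    unfolding P_def sum_distrib_left
    by (rule sum.cong) (simp_all add: lumped_def layer_f_nodes divide_simps, simp add: algebra_simps)
  then have "sum lumped idx = h * H * (\<Sum>\<tau>\<in>{1, -1}. - P \<tau> / (3 * \<epsilon>\<^sup>2))"
    unfolding sum_idx by (simp add: field_simps)
  then have "(\<Sum>\<tau>\<in>{1, -1}. - P \<tau> / (3 * \<epsilon>\<^sup>2)) \<le>
      (\<Sum>\<tau>\<in>{1, -1}. (?r \<tau> N - ?r \<tau> 0 + 2 * M) / h\<^sup>2 + 2 * M * (real N)\<^sup>2 / H\<^sup>2)"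
    using upper_bd h_pos H_pos sum_stiffness_eq_sum_lumped by simp
  then have "\<epsilon>\<^sup>2 * (\<Sum>\<tau>\<in>{1, -1}. - P \<tau> / (3 * \<epsilon>\<^sup>2)) \<le>
      \<epsilon>\<^sup>2 * (\<Sum>\<tau>\<in>{1, -1}. (?r \<tau> N - ?r \<tau> 0 + 2 * M) / h\<^sup>2 + 2 * M * (real N)\<^sup>2 / H\<^sup>2)"
    by (rule mult_left_mono) simp
  also have "\<epsilon>\<^sup>2 * (\<Sum>\<tau>\<in>{1, -1}. - P \<tau> / (3 * \<epsilon>\<^sup>2)) = (\<Sum>\<tau>\<in>{1, -1}. - P \<tau> / 3)"
    using eps_pos by (simp add: field_simps)
  also have "\<epsilon>\<^sup>2 * (\<Sum>\<tau>\<in>{1, -1}. (?r \<tau> N - ?r \<tau> 0 + 2 * M) / h\<^sup>2 + 2 * M * (real N)\<^sup>2 / H\<^sup>2) =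
      (\<Sum>\<tau>\<in>{1, -1}. (real N)\<^sup>2 * (?r \<tau> N - ?r \<tau> 0 + 2 * M) + 2 * M * (real N)\<^sup>2 * (\<epsilon> / H)\<^sup>2)"
  proof -
    have "\<epsilon>\<^sup>2 * (a / h\<^sup>2 + b / H\<^sup>2) = (real N)\<^sup>2 * a + b * (\<epsilon> / H)\<^sup>2" for a b
      using eps_pos H_pos N_pos by (simp add: h_def power_divide field_simps)
    then show ?thesis by (simp only: sum_distrib_left)
  qed
  finally have le: "(\<Sum>\<tau>\<in>{1, -1}. - P \<tau> / 3) \<le>
      (\<Sum>\<tau>\<in>{1, -1}. (real N)\<^sup>2 * (?r \<tau> N - ?r \<tau> 0 + 2 * M) + 2 * M * (real N)\<^sup>2 * (\<epsilon> / H)\<^sup>2)" .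
  \<comment> \<open>Stated for arbitrary \<open>k\<close> in place of
    \<open>(\<epsilon> / H)\<^sup>2\<close>, which keeps the quotient out of the arithmetic.\<close>
  have "real N * exp (- 1) / 3 \<le> real N * (4 * M * real N * (1 + k))"
    if "(\<Sum>\<tau>\<in>{1, -1}. - P \<tau> / 3) \<le>
      (\<Sum>\<tau>\<in>{1, -1}. (real N)\<^sup>2 * (?r \<tau> N - ?r \<tau> 0 + 2 * M) + 2 * M * (real N)\<^sup>2 * k)" for k
    using layer_val_balance[OF N_pos, folded P_def] that by (simp add: algebra_simps power2_eq_square)
  from this[OF le] have "real N * (exp (- 1) / 3) \<le> real N * (4 * M * real N * (1 + (\<epsilon> / H)\<^sup>2))"
    by simp
  then show ?thesis by (rule mult_left_le_imp_le) (use N_pos in simp)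
qed

section \<open>From nodal errors to the maximum over the closed domain\<close>

lemma vertices_subset: "vertices \<T> \<subseteq> closure \<Omega>"
  using triangulation_Union[OF tri] by (auto simp: vertices_def extreme_point_of_def)

text \<open>The error is continuous on a compact set, hence bounded there, so the supremum is a
  genuine upper bound.\<close>

lemma error_le_SUP:
  assumes "p \<in> closure \<Omega>"
  shows "\<bar>U p - layer_u \<epsilon> p\<bar> \<le> (SUP z\<in>closure \<Omega>. \<bar>U z - layer_u \<epsilon> z\<bar>)"
proof (rule cSUP_upper[OF assms])
  have "continuous_on (closure \<Omega>) U"
    using U_fe triangulation_Union[OF tri] by (simp add: fe_space_def)
  moreover have "layer_u \<epsilon> = (\<lambda>z. exp (- fst z / \<epsilon>))" by (auto simp: layer_u_def)
  ultimately have "continuous_on (closure \<Omega>) (\<lambda>z. \<bar>U z - layer_u \<epsilon> z\<bar>)"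
    using eps_pos by (auto intro!: continuous_intros)
  moreover have "compact (closure \<Omega>)"
    using domain by (simp add: polygonal_domain_def compact_closure)
  ultimately show "bdd_above ((\<lambda>z. \<bar>U z - layer_u \<epsilon> z\<bar>) ` closure \<Omega>)"
    by (intro bounded_imp_bdd_above compact_imp_bounded compact_continuous_image)
qed

end

theorem lemma5p2:
  shows "\<forall>C\<^sub>2>0. \<exists>C\<^sub>0>0. \<exists>C\<^sub>1>0.
    \<forall>(\<epsilon>::real) (H::real) (N\<^sub>0::nat) (\<Omega>::(real \<times> real) set) \<T> U.
      \<epsilon> > 0 \<longrightarrow> H > 0 \<longrightarrow> N\<^sub>0 \<ge> 1 \<longrightarrow>
      polygonal_domain \<Omega> \<longrightarrow> local_domain \<epsilon> H \<subseteq> \<Omega> \<longrightarrow>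
      triangulation_of \<T> \<Omega> \<longrightarrow> type_C \<epsilon> H N\<^sub>0 \<subseteq> \<T> \<longrightarrow>
      lumped_mass_solution \<Omega> \<T> (layer_f \<epsilon>) (layer_u \<epsilon>) U \<longrightarrow>
      1 / real N\<^sub>0 \<le> C\<^sub>1 \<longrightarrow> \<epsilon> \<le> C\<^sub>2 * H \<longrightarrow>
      (SUP z\<in>closure \<Omega>. \<bar>U z - layer_u \<epsilon> z\<bar>) \<ge> C\<^sub>0 * (1 / real N\<^sub>0)"
proof -
  \<comment> \<open>The constant results from inserting
    \<open>(\<epsilon> / H)\<^sup>2 \<le> C\<^sup>2\<close> into \<open>error_lower_bound\<close>
    and solving for \<open>M\<close>.\<close>
  have main: "exp (- 1) / (12 * (1 + C\<^sup>2)) * (1 / real N) \<le> (SUP z\<in>closure \<Omega>. \<bar>U z - layer_u \<epsilon> z\<bar>)"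
    if "C > 0" "\<epsilon> > 0" "H > 0" "N \<ge> 1" "polygonal_domain \<Omega>" "local_domain \<epsilon> H \<subseteq> \<Omega>"
      "triangulation_of \<T> \<Omega>" "type_C \<epsilon> H N \<subseteq> \<T>"
      "lumped_mass_solution \<Omega> \<T> (layer_f \<epsilon>) (layer_u \<epsilon>) U" "\<epsilon> \<le> C * H"
    for C \<epsilon> H :: real and N \<Omega> \<T> U
  proof -
    interpret layer_solution \<epsilon> H N \<Omega> \<T> U
      using that by unfold_locales
    define M where "M = (SUP z\<in>closure \<Omega>. \<bar>U z - layer_u \<epsilon> z\<bar>)"
    have M: "\<bar>U p - layer_u \<epsilon> p\<bar> \<le> M" if "p \<in> vertices \<T>" for p
      unfolding M_def using error_le_SUP vertices_subset that by blast
    \<comment> \<open>Any vertex shows \<open>0 \<le> M\<close>, which the monotonicity step below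
      requires.\<close>
    have "(X 1 1, 0) \<in> vertices \<T>"
      using node_vertices(1)[of 1 1 1] N_pos by simp
    from M[OF this] have "0 \<le> M" by simp
    moreover have "(\<epsilon> / H)\<^sup>2 \<le> C\<^sup>2"
      using that by (intro power_mono) (simp_all add: pos_divide_le_eq)
    ultimately have "4 * M * real N * (1 + (\<epsilon> / H)\<^sup>2) \<le> 4 * M * real N * (1 + C\<^sup>2)"
      by (intro mult_left_mono) auto
    with error_lower_bound[OF M] have "exp (- 1) / 3 \<le> 4 * M * real N * (1 + C\<^sup>2)"
      by (rule order_trans)
    then have "exp (- 1) \<le> M * (12 * (1 + C\<^sup>2) * real N)" by (simp add: algebra_simps)
    moreover have "0 < 12 * (1 + C\<^sup>2) * real N" using N_pos by (simp add: add_pos_nonneg)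
    ultimately have "exp (- 1) / (12 * (1 + C\<^sup>2) * real N) \<le> M" by (subst pos_divide_le_eq)
    then show ?thesis unfolding M_def by simp
  qed
  show ?thesis
  proof (intro allI impI)
    fix C\<^sub>2 :: real assume "C\<^sub>2 > 0"
    moreover have "exp (- 1) / (12 * (1 + C\<^sub>2\<^sup>2)) > 0"
      by (simp add: add_pos_nonneg)
    ultimately show "\<exists>C\<^sub>0>0. \<exists>C\<^sub>1>0. \<forall>\<epsilon> H N\<^sub>0 \<Omega> \<T> U.
      \<epsilon> > 0 \<longrightarrow> H > 0 \<longrightarrow> N\<^sub>0 \<ge> 1 \<longrightarrow>
      polygonal_domain \<Omega> \<longrightarrow> local_domain \<epsilon> H \<subseteq> \<Omega> \<longrightarrow>
      triangulation_of \<T> \<Omega> \<longrightarrow> type_C \<epsilon> H N\<^sub>0 \<subseteq> \<T> \<longrightarrow>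
      lumped_mass_solution \<Omega> \<T> (layer_f \<epsilon>) (layer_u \<epsilon>) U \<longrightarrow>
      1 / real N\<^sub>0 \<le> C\<^sub>1 \<longrightarrow> \<epsilon> \<le> C\<^sub>2 * H \<longrightarrow>
      (SUP z\<in>closure \<Omega>. \<bar>U z - layer_u \<epsilon> z\<bar>) \<ge> C\<^sub>0 * (1 / real N\<^sub>0)"
      using main by (intro exI[of _ "exp (- 1) / (12 * (1 + C\<^sub>2\<^sup>2))"] exI[of _ 1] conjI allI impI) auto
  qed
qed

end
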